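(* Let $k$ be a positive integer and let $\mathsf{P} \in \{\mathsf{RT}^2_k, \mathsf{SRT}^2_k\}$. Then $\mathsf{P}^{\textsc{fe}} \equiv_{W} (\mathsf{C}_{\mathbb{N}} \rightarrow \mathsf{P})$.
   Context: A problem is a partial multifunction $\mathsf{P} : \subseteq 2^\omega \rightrightarrows 2^\omega$; elements $X \in \mathrm{dom}(\mathsf{P})$ are its instances, and elements of $\mathsf{P}(X)$ are the solutions to $X$. Colorings, pairs, numbers, etc. are coded as elements of $2^\omega$ in a standard way. $\mathsf{Q} \leq_{W} \mathsf{P}$ means there are Turing functionals $\Phi, \Psi$ such that for every instance $X$ of $\mathsf{Q}$, $\Phi^X$ is an instance of $\mathsf{P}$, and for every solution $\widehat{Y}$ to $\Phi^X$, $\Psi^{X \oplus \widehat{Y}}$ is a solution to $X$. $\mathsf{P}\equiv_{W}\mathsf{Q}$ means $\mathsf{P}\leq_{W}\mathsf{Q}$ and $\mathsf{Q}\leq_{W}\mathsf{P}$. Composition $\mathsf{P}_1 \circ \mathsf{P}_0$: instances are the $\mathsf{P}_0$-instances $X$ such that every $\mathsf{P}_0$-solution to $X$ is a $\mathsf{P}_1$-instance; solutions are the $\mathsf{P}_1$-solutions to the $\mathsf{P}_0$-solutions to $X$. Compositional product $\mathsf{P}_1 \star \mathsf{P}_0$: the Weihrauch degree $\max_{\leq_{W}}\{\mathsf{Q}_1 \circ \mathsf{Q}_0 : \mathsf{Q}_i \leq_{W} \mathsf{P}_i\}$ (known to exist). Implication: for problems $\mathsf{P},\mathsf{Q}$,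 $\mathsf{Q}\to\mathsf{P}$ denotes the Weihrauch degree $\inf_{\leq_{W}}\{\mathsf{R} : \mathsf{P} \leq_{W} \mathsf{Q} \star \mathsf{R}\}$ (this infimum is known to exist). Write $[X]^2 = \{\langle x,y\rangle \in X\times X : x<y\}$ and $k=\{0,\dots,k-1\}$. A coloring $c:[\omega]^2\to k$ is stable if for every $x$, $\lim_y c(x,y)$ exists; $H$ is homogeneous for $c$ if $c$ is constant on $[H]^2$. $\mathsf{RT}^2_k$: instances are colorings $c:[\omega]^2\to k$; solutions are infinite homogeneous sets. $\mathsf{SRT}^2_k$: its restriction to stable colorings. For a problem $\mathsf{P}$, $\mathsf{P}^{\textsc{fe}}$ is the problem with the same instances as $\mathsf{P}$, where $Y$ is a solution to $X$ iff there is a $\mathsf{P}$-solution $Z$ to $X$ with $Y =^* Z$ (i.e. $Y$ and $Z$ differ on only finitely many elements). $\mathsf{C}_{\mathbb{N}}$: instances are functions $e:\omega^2\to 2$ such that for all $x$, $e(x,0)=0$ and there is at most one $s$ with $e(x,s)\neq e(x,s+1)$, and there is at least one $x$ with $e(x,s)=0$ for all $s$; solutions to $e$ are all $x\in\omega$ such that $e(x,s)=0$ for all $s$. *)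

theory Defs
  imports Complex_Main "HOL-Library.Nat_Bijection" "HOL-Library.Ramsey"
begin

text \<open>Points of Cantor space are sets of natural numbers, identified with their
  characteristic functions.\<close>

type_synonym cantor = "nat set"

definition join :: "cantor \<Rightarrow> cantor \<Rightarrow> cantor"  (infixl "\<oplus>" 65) where
  "X \<oplus> Y = {2 * n | n. n \<in> X} \<union> {2 * n + 1 | n. n \<in> Y}"


text \<open>A Turing functional is given by a program of Kleene's partial recursive schemes relative to
  an oracle. All programs are unary; tuples are passed via the pairing function \<open>prod_encode\<close>.\<close>

datatype functional =
    TZero | TSucc | TFst | TSnd | TOracle
  | TPair functional functional
  | TComp functional functional
  | TPrec functional functional
  | TMu functional

text \<open>\<open>eval X p n m\<close>: the program \<open>p\<close> with oracle \<open>X\<close> halts on input \<open>n\<close> with output \<open>m\<close>.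
  Minimisation requires all earlier values to be defined and nonzero.\<close>

inductive eval :: "cantor \<Rightarrow> functional \<Rightarrow> nat \<Rightarrow> nat \<Rightarrow> bool" for X where
  eval_zero: "eval X TZero n 0"
| eval_succ: "eval X TSucc n (Suc n)"
| eval_fst: "eval X TFst n (fst (prod_decode n))"
| eval_snd: "eval X TSnd n (snd (prod_decode n))"
| eval_oracle: "eval X TOracle n (of_bool (n \<in> X))"
| eval_pair: "eval X p n a \<Longrightarrow> eval X q n b \<Longrightarrow> eval X (TPair p q) n (prod_encode (a, b))"
| eval_comp: "eval X q n a \<Longrightarrow> eval X p a b \<Longrightarrow> eval X (TComp p q) n b"
| eval_prec_0: "eval X p a b \<Longrightarrow> eval X (TPrec p q) (prod_encode (a, 0)) b"
| eval_prec_Suc: "eval X (TPrec p q) (prod_encode (a, m)) r \<Longrightarrow>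
    eval X q (prod_encode (a, prod_encode (m, r))) b \<Longrightarrow>
    eval X (TPrec p q) (prod_encode (a, Suc m)) b"
| eval_mu: "eval X p (prod_encode (a, m)) 0 \<Longrightarrow>
    \<forall>i<m. \<exists>r. eval X p (prod_encode (a, i)) (Suc r) \<Longrightarrow>
    eval X (TMu p) a m"

text \<open>\<open>computes \<Phi> X Y\<close> says that \<open>\<Phi>\<^sup>X\<close> is total and is the characteristic function of \<open>Y\<close>.
  By lemma \<open>computes_unique\<close> below there is at most one such \<open>Y\<close>.\<close>

definition computes :: "functional \<Rightarrow> cantor \<Rightarrow> cantor \<Rightarrow> bool" where
  "computes \<Phi> X Y \<longleftrightarrow> (\<forall>n. eval X \<Phi> n (of_bool (n \<in> Y)))"


text \<open>A partial multifunction is a set-valued function whose domain consists of the points with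
  nonempty value (the usual convention for multifunctions).\<close>

type_synonym problem = "cantor \<Rightarrow> cantor set"

definition dom_problem :: "problem \<Rightarrow> cantor set" where
  "dom_problem P = {X. P X \<noteq> {}}"

definition W_le :: "problem \<Rightarrow> problem \<Rightarrow> bool"  (infix "\<le>\<^sub>W" 50) where
  "Q \<le>\<^sub>W P \<longleftrightarrow> (\<exists>\<Phi> \<Psi>. \<forall>X \<in> dom_problem Q. \<exists>X'. computes \<Phi> X X' \<and> X' \<in> dom_problem P \<and>
     (\<forall>Y' \<in> P X'. \<exists>Y. computes \<Psi> (X \<oplus> Y') Y \<and> Y \<in> Q X))"

definition W_equiv :: "problem \<Rightarrow> problem \<Rightarrow> bool"  (infix "\<equiv>\<^sub>W" 50) where
  "P \<equiv>\<^sub>W Q \<longleftrightarrow> P \<le>\<^sub>W Q \<and> Q \<le>\<^sub>W P"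


text \<open>A Weihrauch degree is a set of problems, namely an equivalence class of \<open>\<equiv>\<^sub>W\<close>.\<close>

definition W_degree :: "problem \<Rightarrow> problem set" where
  "W_degree P = {Q. Q \<equiv>\<^sub>W P}"

definition W_le_degree :: "problem \<Rightarrow> problem set \<Rightarrow> bool" where
  "W_le_degree P D \<longleftrightarrow> (\<exists>S \<in> D. P \<le>\<^sub>W S)"

text \<open>The degree of a \<open>\<le>\<^sub>W\<close>-maximum (greatest element up to \<open>\<equiv>\<^sub>W\<close>), resp.\ of a
  \<open>\<le>\<^sub>W\<close>-infimum, of a class of problems; the empty set if there is none.\<close>

definition W_max :: "problem set \<Rightarrow> problem set" where
  "W_max A = {S. (\<exists>T \<in> A. S \<equiv>\<^sub>W T) \<and> (\<forall>T \<in> A. T \<le>\<^sub>W S)}"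

definition W_inf :: "problem set \<Rightarrow> problem set" where
  "W_inf A = {S. (\<forall>R \<in> A. S \<le>\<^sub>W R) \<and> (\<forall>T. (\<forall>R \<in> A. T \<le>\<^sub>W R) \<longrightarrow> T \<le>\<^sub>W S)}"

definition problem_comp :: "problem \<Rightarrow> problem \<Rightarrow> problem"  (infixl "\<circ>\<^sub>p" 55) where
  "(P1 \<circ>\<^sub>p P0) X =
     (if X \<in> dom_problem P0 \<and> P0 X \<subseteq> dom_problem P1 then (\<Union>Y \<in> P0 X. P1 Y) else {})"

definition comp_product :: "problem \<Rightarrow> problem \<Rightarrow> problem set"  (infix "\<star>" 60) where
  "P1 \<star> P0 = W_max {Q1 \<circ>\<^sub>p Q0 | Q1 Q0. Q1 \<le>\<^sub>W P1 \<and> Q0 \<le>\<^sub>W P0}"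

definition W_imp :: "problem \<Rightarrow> problem \<Rightarrow> problem set"  (infix "\<rightarrow>\<^sub>W" 55) where
  "(Q \<rightarrow>\<^sub>W P) = W_inf {R. W_le_degree P (Q \<star> R)}"


text \<open>A coloring of \<open>[\<omega>]\<^sup>2\<close> is a binary function of which only the values with
  \<open>x < y\<close> matter; its code is its graph.\<close>

definition coloring :: "nat \<Rightarrow> (nat \<Rightarrow> nat \<Rightarrow> nat) \<Rightarrow> bool" where
  "coloring k c \<longleftrightarrow> (\<forall>x y. x < y \<longrightarrow> c x y < k)"

definition coloring_code :: "(nat \<Rightarrow> nat \<Rightarrow> nat) \<Rightarrow> cantor" where
  "coloring_code c = {prod_encode (prod_encode (x, y), c x y) | x y. x < y}"

text \<open>Convergence is with respect to the discrete topology on \<open>nat\<close>.\<close>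

definition stable :: "(nat \<Rightarrow> nat \<Rightarrow> nat) \<Rightarrow> bool" where
  "stable c \<longleftrightarrow> (\<forall>x. convergent (\<lambda>y. c x y))"

definition homogeneous :: "(nat \<Rightarrow> nat \<Rightarrow> nat) \<Rightarrow> nat set \<Rightarrow> bool" where
  "homogeneous c H \<longleftrightarrow> (\<exists>i. \<forall>x \<in> H. \<forall>y \<in> H. x < y \<longrightarrow> c x y = i)"

definition RT2 :: "nat \<Rightarrow> problem" where
  "RT2 k X = {H. \<exists>c. coloring k c \<and> X = coloring_code c \<and> infinite H \<and> homogeneous c H}"

definition SRT2 :: "nat \<Rightarrow> problem" where
  "SRT2 k X = {H. \<exists>c. coloring k c \<and> stable c \<and> X = coloring_code c \<and>
     infinite H \<and> homogeneous c H}"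

definition FE :: "problem \<Rightarrow> problem" where
  "FE P X = {Y. \<exists>Z \<in> P X. finite ((Y - Z) \<union> (Z - Y))}"

definition CN_instance :: "(nat \<Rightarrow> nat \<Rightarrow> nat) \<Rightarrow> bool" where
  "CN_instance e \<longleftrightarrow>
     (\<forall>x s. e x s < 2) \<and>
     (\<forall>x. e x 0 = 0 \<and> (\<exists>\<^sub>\<le>\<^sub>1 s. e x s \<noteq> e x (s + 1))) \<and>
     (\<exists>x. \<forall>s. e x s = 0)"

text \<open>Functions \<open>\<omega>\<^sup>2 \<rightarrow> 2\<close> are coded as characteristic functions of sets of pairs,
  numbers \<open>x\<close> as singletons \<open>{x}\<close>.\<close>

definition CN :: problem where
  "CN X = {{x} | x. \<exists>e. CN_instance e \<and> X = {prod_encode (y, s) | y s. e y s = 1} \<and>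
     (\<forall>s. e x s = 0)}"


lemma eval_deterministic: "eval X p n a \<Longrightarrow> eval X p n b \<Longrightarrow> a = b"
proof (induction arbitrary: b rule: eval.induct)
  case (eval_pair p n a q b')
  from eval_pair.prems show ?case by cases (use eval_pair.IH in auto)
next
  case (eval_comp q n a p b')
  from eval_comp.prems show ?case by cases (use eval_comp.IH in auto)
next
  case (eval_prec_0 p a b' q)
  from eval_prec_0.prems show ?case by cases (use eval_prec_0.IH in auto)
next
  case (eval_prec_Suc p q a m r b')
  from eval_prec_Suc.prems show ?case by cases (use eval_prec_Suc.IH in auto)
next
  case (eval_mu p a m)
  from eval_mu.prems show ?case
  proof cases
    case eval_mu
    then show ?thesis using eval_mu.IH
      by (metis Zero_not_Suc linorder_neqE_nat)
  qed
qed (auto elim: eval.cases)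

lemma computes_unique:
  assumes "computes \<Phi> X Y" "computes \<Phi> X Z"
  shows "Y = Z"
proof -
  have "(of_bool (n \<in> Y) :: nat) = of_bool (n \<in> Z)" for n
    using assms eval_deterministic unfolding computes_def by blast
  then show ?thesis by (auto simp: of_bool_eq_iff)
qed

text \<open>The domains are the intended sets of instances.\<close>

lemma coloring_has_solution:
  assumes "coloring k c"
  shows "\<exists>H. infinite H \<and> homogeneous c H"
proof -
  define f where "f A = c (Min A) (Max A)" for A
  have f: "f {x, y} = c (min x y) (max x y)" for x y
    by (simp add: f_def)
  have "f {x, y} < k" if "x \<noteq> y" for x y
    using assms that by (cases x y rule: linorder_cases) (simp_all add: f coloring_def)
  then have "\<forall>x\<in>UNIV. \<forall>y\<in>UNIV. x \<noteq> y \<longrightarrow> f {x, y} < k"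
    by simp
  from Ramsey2[OF infinite_UNIV_nat this] obtain Y t where "infinite Y"
    and Y: "\<forall>x\<in>Y. \<forall>y\<in>Y. x \<noteq> y \<longrightarrow> f {x, y} = t"
    by (elim exE conjE)
  have "c x y = t" if "x \<in> Y" "y \<in> Y" "x < y" for x y
  proof -
    have "x \<noteq> y" using that by simp
    then have "f {x, y} = t" using Y that by simp
    then show ?thesis using that by (simp add: f)
  qed
  then have "homogeneous c Y" unfolding homogeneous_def by (intro exI[of _ t] ballI impI)
  with \<open>infinite Y\<close> show ?thesis by (intro exI conjI)
qed

lemma dom_RT2: "dom_problem (RT2 k) = {coloring_code c | c. coloring k c}"
  unfolding dom_problem_def RT2_def using coloring_has_solution by blast

lemma dom_SRT2: "dom_problem (SRT2 k) = {coloring_code c | c. coloring k c \<and> stable c}"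
  unfolding dom_problem_def SRT2_def using coloring_has_solution by blast

lemma dom_FE: "dom_problem (FE P) = dom_problem P"
proof -
  have "Y \<in> FE P X" if "Y \<in> P X" for X Y
    using that by (auto simp: FE_def intro!: bexI[of _ Y])
  then show ?thesis by (auto simp: dom_problem_def FE_def)
qed

lemma dom_CN:
  "dom_problem CN = {{prod_encode (y, s) | y s. e y s = 1} | e. CN_instance e}"
  by (auto simp: dom_problem_def CN_def CN_instance_def)

end

theory Submission
  imports Defs
begin

text \<open>The degree of \<^term>\<open>CN \<rightarrow>\<^sub>W P\<close> is the infimum of the problems \<open>R\<close> with
  \<open>P\<close> below \<open>CN \<star> R\<close>. So it is enough that \<open>FE P\<close> is a lower bound of these problems and is
  itself one of them.

  Lower bound (\<open>FE_le_of_le_comp_CN\<close>; this holds for every problem \<open>P\<close>). Suppose that \<open>P\<close> is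
  solved by an \<open>R\<close>-solution followed by one use of \<open>CN\<close>. The \<open>CN\<close>-instance \<open>E\<close> that arises can be
  computed, and the first candidate that has not yet been refuted converges to a correct answer
  \<open>x\<close>. To decide whether \<open>n\<close> belongs to the desired solution, run the backward functional on \<open>n\<close> at
  stages \<open>t \<ge> n\<close>, each time with the current candidate and with all minimisations bounded by
  \<open>t\<close>, and believe the first computation that halts. Late stages all use \<open>x\<close>, so some computation halts, and for large \<open>n\<close>
  every stage that is looked at uses \<open>x\<close>. The result differs from the \<open>P\<close>-solution obtained from
  \<open>x\<close> only finitely often.

  Membership (\<open>homogeneous_set_problem_le_comp\<close>). If \<open>H\<close> is homogeneous up to finitely many errors,
  then \<open>H\<close> becomes homogeneous when a long enough initial segment is removed. That \<open>n\<close> is not long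
  enough is witnessed by two pairs of different colours above \<open>n\<close>, hence is recognised at some
  finite stage, and \<open>CN\<close> finds an \<open>n\<close> for which this never happens.

  The second part also needs a maximum in the definition of \<open>CN \<star> FE P\<close>
  (\<open>comp_product_nonempty\<close>): otherwise the set of representatives would be empty. For problems
  \<open>P1\<close> and \<open>P0\<close> the maximum takes a \<open>P0\<close>-instance together with a continuous functional that turns
  its solutions into \<open>P1\<close>-instances. The functional is given by its table of values on finite
  oracle prefixes, a Kleene associate, so that one fixed functional can apply all of them
  (\<open>computes_associate\<close>).

  Both the stagewise search and the tables rest on an evaluation function with bounded
  minimisation (\<open>run\<close>) which is total and, for each fixed program, computable.\<close>

section \<open>Computable functions relative to an oracle\<close>

abbreviation npair :: "nat \<Rightarrow> nat \<Rightarrow> nat"  ("\<langle>_,/ _\<rangle>") where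
  "\<langle>a, b\<rangle> \<equiv> prod_encode (a, b)"

abbreviation nfst :: "nat \<Rightarrow> nat" where
  "nfst z \<equiv> fst (prod_decode z)"

abbreviation nsnd :: "nat \<Rightarrow> nat" where
  "nsnd z \<equiv> snd (prod_decode z)"

text \<open>Totality is required for every oracle, with one program for all of them. This gives closure
  under composition without side conditions; partial functions enter only through
  \<open>search_computes\<close> below.\<close>

definition computable :: "(cantor \<Rightarrow> nat \<Rightarrow> nat) \<Rightarrow> bool" where
  "computable f \<longleftrightarrow> (\<exists>p. \<forall>X n. eval X p n (f X n))"

abbreviation decidable :: "(cantor \<Rightarrow> nat \<Rightarrow> bool) \<Rightarrow> bool" where
  "decidable R \<equiv> computable (\<lambda>X n. of_bool (R X n))"

text \<open>A constant rather than an abbreviation: it keeps the rule \<open>decidable_member\<close> from applying to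
  its own premise.\<close>

definition operator :: "(cantor \<Rightarrow> cantor) \<Rightarrow> bool" where
  "operator G \<longleftrightarrow> decidable (\<lambda>X n. n \<in> G X)"

named_theorems computable_intros

lemma computable_id [computable_intros]: "computable (\<lambda>X n. n)"
proof -
  have "eval X (TPair TFst TSnd) n n" for X n
    using eval_pair[OF eval_fst eval_snd, of X n] by simp
  then show ?thesis unfolding computable_def by blast
qed

lemma computable_comp:
  assumes "computable F" "computable f"
  shows "computable (\<lambda>X n. F X (f X n))"
  using assms unfolding computable_def by (meson eval_comp)

lemma computable_zero: "computable (\<lambda>X n. 0)"
  unfolding computable_def by (meson eval_zero)

lemma computable_Suc [computable_intros]:
  "computable f \<Longrightarrow> computable (\<lambda>X n. Suc (f X n))"
  unfolding computable_def by (meson eval_comp eval_succ)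

lemma computable_const [computable_intros]: "computable (\<lambda>X n. k)"
  by (induction k) (auto intro: computable_zero computable_Suc)

lemma computable_nfst [computable_intros]:
  "computable f \<Longrightarrow> computable (\<lambda>X n. nfst (f X n))"
  unfolding computable_def by (meson eval_comp eval_fst)

lemma computable_nsnd [computable_intros]:
  "computable f \<Longrightarrow> computable (\<lambda>X n. nsnd (f X n))"
  unfolding computable_def by (meson eval_comp eval_snd)

lemma computable_npair [computable_intros]:
  "computable f \<Longrightarrow> computable g \<Longrightarrow> computable (\<lambda>X n. \<langle>f X n, g X n\<rangle>)"
  unfolding computable_def by (meson eval_pair)

lemma computable_comp2:
  assumes "computable (\<lambda>X z. F X (nfst z) (nsnd z))" "computable f" "computable g"
  shows "computable (\<lambda>X n. F X (f X n) (g X n))"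
  using computable_comp[OF assms(1) computable_npair[OF assms(2,3)]] by simp

lemma computable_comp3:
  assumes "computable (\<lambda>X z. F X (nfst z) (nfst (nsnd z)) (nsnd (nsnd z)))"
    and "computable f" "computable g" "computable h"
  shows "computable (\<lambda>X n. F X (f X n) (g X n) (h X n))"
  using computable_comp[OF assms(1) computable_npair[OF assms(2) computable_npair[OF assms(3,4)]]]
  by simp

lemma computable_rec_nat [computable_intros]:
  assumes "computable f"
    and "computable (\<lambda>X z. h X (nfst z) (nfst (nsnd z)) (nsnd (nsnd z)))"
    and "computable m"
  shows "computable (\<lambda>X n. rec_nat (f X n) (h X n) (m X n))"
proof -
  obtain pf ph where pf: "\<And>X n. eval X pf n (f X n)"
    and ph: "\<And>X z. eval X ph z (h X (nfst z) (nfst (nsnd z)) (nsnd (nsnd z)))"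
    using assms(1,2) unfolding computable_def by blast
  have "eval X (TPrec pf ph) \<langle>a, k\<rangle> (rec_nat (f X a) (h X a) k)" for X a k
  proof (induction k)
    case 0
    show ?case using eval_prec_0[OF pf] by simp
  next
    case (Suc k)
    show ?case using eval_prec_Suc[OF Suc ph] by simp
  qed
  then have "eval X (TPrec pf ph) z (rec_nat (f X (nfst z)) (h X (nfst z)) (nsnd z))" for X z
    by (metis prod.collapse prod_decode_inverse)
  then have "computable (\<lambda>X z. rec_nat (f X (nfst z)) (h X (nfst z)) (nsnd z))"
    unfolding computable_def by blast
  from computable_comp2[OF this computable_id assms(3)] show ?thesis .
qed

lemma computable_case_nat [computable_intros]:
  assumes "computable f" "computable (\<lambda>X z. h X (nfst z) (nsnd z))" "computable m"
  shows "computable (\<lambda>X n. case m X n of 0 \<Rightarrow> f X n | Suc v \<Rightarrow> h X n v)"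
proof -
  have "computable (\<lambda>X n. rec_nat (f X n) (\<lambda>v _. h X n v) (m X n))"
    by (intro computable_intros computable_comp2[OF assms(2)] assms(1,3))
  moreover have "rec_nat a (\<lambda>v _. g v) k = (case k of 0 \<Rightarrow> a | Suc v \<Rightarrow> g v)"
    for a k :: nat and g by (cases k) auto
  ultimately show ?thesis by simp
qed

lemma computable_if [computable_intros]:
  assumes "decidable b" "computable f" "computable g"
  shows "computable (\<lambda>X n. if b X n then f X n else g X n)"
proof -
  have "computable (\<lambda>X n. case of_bool (b X n) of 0 \<Rightarrow> g X n | Suc v \<Rightarrow> f X n)"
    by (intro computable_intros assms computable_comp[OF assms(2)] computable_comp[OF assms(3)])
  moreover have "(case of_bool c of 0 \<Rightarrow> y | Suc v \<Rightarrow> x) = (if c then x else y)"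
    for c and x y :: nat by simp
  ultimately show ?thesis by simp
qed

lemma decidable_not [computable_intros]:
  assumes "decidable b" shows "decidable (\<lambda>X n. \<not> b X n)"
proof -
  have "computable (\<lambda>X n. if b X n then 0 else 1)"
    by (intro computable_intros assms)
  moreover have "(if c then 0 else 1) = (of_bool (\<not> c) :: nat)" for c by simp
  ultimately show ?thesis by simp
qed

lemma decidable_conj [computable_intros]:
  assumes "decidable b" "decidable c" shows "decidable (\<lambda>X n. b X n \<and> c X n)"
proof -
  have "computable (\<lambda>X n. if b X n then of_bool (c X n) else 0)"
    by (intro computable_intros assms)
  moreover have "(if u then of_bool v else 0) = (of_bool (u \<and> v) :: nat)" for u v by simp
  ultimately show ?thesis by simp
qed

lemma decidable_disj [computable_intros]:
  assumes "decidable b" "decidable c" shows "decidable (\<lambda>X n. b X n \<or> c X n)"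
proof -
  have "decidable (\<lambda>X n. \<not> (\<not> b X n \<and> \<not> c X n))"
    by (intro computable_intros assms)
  then show ?thesis by simp
qed

lemma computable_add [computable_intros]:
  assumes "computable f" "computable g"
  shows "computable (\<lambda>X n. f X n + g X n)"
proof -
  have "computable (\<lambda>X n. rec_nat (f X n) (\<lambda>_ r. Suc r) (g X n))"
    by (intro computable_intros assms)
  moreover have "rec_nat a (\<lambda>_ r. Suc r) k = a + k" for a k by (induction k) auto
  ultimately show ?thesis by simp
qed

lemma computable_diff [computable_intros]:
  assumes "computable f" "computable g"
  shows "computable (\<lambda>X n. f X n - g X n)"
proof -
  have "computable (\<lambda>X n. rec_nat (f X n) (\<lambda>_ r. case r of 0 \<Rightarrow> 0 | Suc v \<Rightarrow> v) (g X n))"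
    by (intro computable_intros assms)
  moreover have "rec_nat a (\<lambda>_ r. case r of 0 \<Rightarrow> 0 | Suc v \<Rightarrow> v) k = a - k" for a k
    by (induction k) (auto split: nat.split)
  ultimately show ?thesis by simp
qed

lemma decidable_less [computable_intros]:
  assumes "computable f" "computable g"
  shows "decidable (\<lambda>X n. f X n < g X n)"
proof -
  have "computable (\<lambda>X n. case g X n - f X n of 0 \<Rightarrow> 0 | Suc v \<Rightarrow> 1)"
    by (intro computable_intros assms)
  moreover have "(case b - a of 0 \<Rightarrow> 0 | Suc v \<Rightarrow> 1) = (of_bool (a < b) :: nat)" for a b :: nat
    by (auto split: nat.split)
  ultimately show ?thesis by simp
qed

lemma decidable_le [computable_intros]:
  assumes "computable f" "computable g"
  shows "decidable (\<lambda>X n. f X n \<le> g X n)"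
proof -
  have "decidable (\<lambda>X n. f X n < Suc (g X n))"
    by (intro computable_intros assms)
  then show ?thesis by (simp add: less_Suc_eq_le)
qed

lemma decidable_eq [computable_intros]:
  fixes f g :: "cantor \<Rightarrow> nat \<Rightarrow> nat"
  assumes "computable f" "computable g"
  shows "decidable (\<lambda>X n. f X n = g X n)"
proof -
  have "decidable (\<lambda>X n. f X n \<le> g X n \<and> g X n \<le> f X n)"
    by (intro computable_intros assms)
  then show ?thesis by (simp flip: order_eq_iff)
qed

lemma decidable_even [computable_intros]:
  assumes "computable f" shows "decidable (\<lambda>X n. even (f X n))"
proof -
  have "computable (\<lambda>X n. rec_nat 1 (\<lambda>_ r. 1 - r) (f X n))"
    by (intro computable_intros assms)
  moreover have "rec_nat 1 (\<lambda>_ r. 1 - r) k = (of_bool (even k) :: nat)" for k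
    by (induction k) auto
  ultimately show ?thesis by simp
qed

lemma computable_half [computable_intros]:
  assumes "computable f" shows "computable (\<lambda>X n. f X n div 2)"
proof -
  have "computable (\<lambda>X n. rec_nat 0 (\<lambda>i r. if even i then r else Suc r) (f X n))"
    by (intro computable_intros assms)
  moreover have "rec_nat 0 (\<lambda>i r. if even i then r else Suc r) k = k div 2" for k
    by (induction k) auto
  ultimately show ?thesis by simp
qed

lemma decidable_bex [computable_intros]:
  assumes "decidable (\<lambda>X z. R X (nfst z) (nsnd z))" "computable m"
  shows "decidable (\<lambda>X n. \<exists>i<m X n. R X n i)"
proof -
  have "computable (\<lambda>X n. rec_nat 0 (\<lambda>i r. if R X n i then 1 else r) (m X n))"
    by (intro computable_intros assms(2) computable_comp2[OF assms(1)])
  moreover have "rec_nat 0 (\<lambda>i r. if Q i then 1 else r) k = (of_bool (\<exists>i<k. Q i) :: nat)" for k Q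
    by (induction k) (auto simp: less_Suc_eq)
  ultimately show ?thesis by simp
qed

lemma decidable_member [computable_intros]:
  assumes "operator G" "computable f"
  shows "decidable (\<lambda>X n. f X n \<in> G X)"
  using computable_comp[OF assms(1)[unfolded operator_def] assms(2)] .

lemma operator_Collect [computable_intros]:
  "decidable R \<Longrightarrow> operator (\<lambda>X. {n. R X n})"
  by (simp add: operator_def)

lemma operator_id [computable_intros]: "operator (\<lambda>X. X)"
  unfolding operator_def computable_def by (meson eval_oracle)

definition left :: "cantor \<Rightarrow> cantor" where "left X = {n. n + n \<in> X}"
definition right :: "cantor \<Rightarrow> cantor" where "right X = {n. Suc (n + n) \<in> X}"

lemma mem_join: "n \<in> A \<oplus> B \<longleftrightarrow> (if even n then n div 2 \<in> A else n div 2 \<in> B)"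
proof -
  have "n = 2 * m \<longleftrightarrow> even n \<and> n div 2 = m" "n = 2 * m + 1 \<longleftrightarrow> odd n \<and> n div 2 = m" for m
    by presburger+
  then show ?thesis unfolding join_def by auto
qed

lemma left_join [simp]: "left (A \<oplus> B) = A"
  by (auto simp: left_def mem_join)

lemma right_join [simp]: "right (A \<oplus> B) = B"
  by (auto simp: right_def mem_join)

lemma operator_left [computable_intros]:
  assumes "operator G" shows "operator (\<lambda>X. left (G X))"
  unfolding left_def by (intro computable_intros assms)

lemma operator_right [computable_intros]:
  assumes "operator G" shows "operator (\<lambda>X. right (G X))"
  unfolding right_def by (intro computable_intros assms)

lemma operator_join [computable_intros]:
  assumes "operator F" "operator G" shows "operator (\<lambda>X. F X \<oplus> G X)"
proof -
  have "decidable (\<lambda>X n. even n \<and> n div 2 \<in> F X \<or> \<not> even n \<and> n div 2 \<in> G X)"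
    by (intro computable_intros assms)
  then show ?thesis by (simp add: operator_def mem_join if_bool_eq_disj)
qed

lemma operator_computes: "operator G \<Longrightarrow> \<exists>p. \<forall>X. computes p X (G X)"
  unfolding operator_def computable_def computes_def by blast

text \<open>The only use of unbounded minimisation. The search may fail for some oracles, hence the
  conclusion is restricted to those for which it always succeeds.\<close>

lemma search_computes:
  assumes "decidable (\<lambda>X z. R X (nfst z) (nsnd z))" "decidable (\<lambda>X z. V X (nfst z) (nsnd z))"
  shows "\<exists>p. \<forall>X. (\<forall>n. \<exists>t. R X n t) \<longrightarrow> computes p X {n. V X n (LEAST t. R X n t)}"
proof -
  have "decidable (\<lambda>X z. \<not> R X (nfst z) (nsnd z))"
    by (intro computable_intros assms)
  then obtain r v where r: "\<And>X z. eval X r z (of_bool (\<not> R X (nfst z) (nsnd z)))"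
    and v: "\<And>X z. eval X v z (of_bool (V X (nfst z) (nsnd z)))"
    using assms(2) unfolding computable_def by blast
  obtain i where i: "\<And>X n. eval X i n n"
    using computable_id unfolding computable_def by blast
  let ?p = "TComp v (TPair i (TMu r))"
  have "computes ?p X {n. V X n (LEAST t. R X n t)}" if ex: "\<forall>n. \<exists>t. R X n t" for X
    unfolding computes_def
  proof
    fix n
    let ?t = "LEAST t. R X n t"
    have "R X n ?t" using ex by (meson LeastI)
    then have "eval X r \<langle>n, ?t\<rangle> 0" using r[of X "\<langle>n, ?t\<rangle>"] by simp
    moreover have "eval X r \<langle>n, u\<rangle> (Suc 0)" if "u < ?t" for u
      using r[of X "\<langle>n, u\<rangle>"] not_less_Least[OF that] by simp
    ultimately have "eval X (TMu r) n ?t" by (blast intro: eval_mu)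
    from eval_comp[OF eval_pair[OF i this] v]
    show "eval X ?p n (of_bool (n \<in> {n. V X n (LEAST t. R X n t)}))" by simp
  qed
  then show ?thesis by blast
qed

section \<open>Composition of functionals and Weihrauch reducibility\<close>

text \<open>Every oracle question of the second program is answered by running the first one.\<close>

primrec subst :: "functional \<Rightarrow> functional \<Rightarrow> functional" where
  "subst q TZero = TZero"
| "subst q TSucc = TSucc"
| "subst q TFst = TFst"
| "subst q TSnd = TSnd"
| "subst q TOracle = q"
| "subst q (TPair p p') = TPair (subst q p) (subst q p')"
| "subst q (TComp p p') = TComp (subst q p) (subst q p')"
| "subst q (TPrec p p') = TPrec (subst q p) (subst q p')"
| "subst q (TMu p) = TMu (subst q p)"

lemma eval_subst:
  assumes "computes q X Y" "eval Y p n m"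
  shows "eval X (subst q p) n m"
  using assms(2)
proof (induction rule: eval.induct)
  case (eval_oracle n)
  then show ?case using assms(1) by (simp add: computes_def)
next
  case (eval_mu p a m)
  then show ?case by (auto intro: eval.eval_mu)
qed (auto intro: eval.intros)

lemma computes_subst:
  "computes q X Y \<Longrightarrow> computes p Y Z \<Longrightarrow> computes (subst q p) X Z"
  using eval_subst unfolding computes_def by blast

lemma computes_oracle: "computes TOracle X X"
  by (simp add: computes_def eval_oracle)

lemma computes_join: "\<exists>r. \<forall>X Y Z. computes p X Y \<longrightarrow> computes q X Z \<longrightarrow> computes r X (Y \<oplus> Z)"
proof -
  have "computable (\<lambda>X z. if even (nfst z) then nfst (nsnd z) else nsnd (nsnd z))"
    "computable (\<lambda>X z. z div 2)"
    by (intro computable_intros)+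
  then obtain c h i where c: "\<And>X z. eval X c z (if even (nfst z) then nfst (nsnd z) else nsnd (nsnd z))"
    and h: "\<And>X n. eval X h n (n div 2)" and i: "\<And>X n. eval X i n n"
    using computable_id unfolding computable_def by blast
  let ?r = "TComp c (TPair i (TPair (TComp p h) (TComp q h)))"
  have "computes ?r X (Y \<oplus> Z)" if "computes p X Y" "computes q X Z" for X Y Z
    unfolding computes_def
  proof
    fix n
    have "eval X p (n div 2) (of_bool (n div 2 \<in> Y))" "eval X q (n div 2) (of_bool (n div 2 \<in> Z))"
      using that by (auto simp: computes_def)
    from eval_comp[OF eval_pair[OF i eval_pair[OF eval_comp[OF h this(1)] eval_comp[OF h this(2)]]] c]
    show "eval X ?r n (of_bool (n \<in> Y \<oplus> Z))"
      by (cases "even n") (simp_all add: mem_join del: of_bool_eq_0_iff split del: split_of_bool)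
  qed
  then show ?thesis by blast
qed

lemma W_le_refl: "P \<le>\<^sub>W P"
proof -
  obtain pr where "\<And>X. computes pr X (right X)"
    using operator_computes[OF operator_right[OF operator_id]] by blast
  then have "computes pr (X \<oplus> Y) Y" for X Y by (metis right_join)
  then show ?thesis unfolding W_le_def using computes_oracle by blast
qed

lemma W_le_trans:
  assumes "P \<le>\<^sub>W Q" "Q \<le>\<^sub>W R"
  shows "P \<le>\<^sub>W R"
proof -
  obtain F1 B1 where 1: "\<And>X. X \<in> dom_problem P \<Longrightarrow> \<exists>X'. computes F1 X X' \<and> X' \<in> dom_problem Q \<and>
     (\<forall>Y' \<in> Q X'. \<exists>Y. computes B1 (X \<oplus> Y') Y \<and> Y \<in> P X)"
    using assms(1) unfolding W_le_def by blast
  obtain F2 B2 where 2: "\<And>X. X \<in> dom_problem Q \<Longrightarrow> \<exists>X'. computes F2 X X' \<and> X' \<in> dom_problem R \<and>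
     (\<forall>Y' \<in> R X'. \<exists>Y. computes B2 (X \<oplus> Y') Y \<and> Y \<in> Q X)"
    using assms(2) unfolding W_le_def by blast
  obtain pl where pl: "\<And>X. computes pl X (left X)"
    using operator_computes[OF operator_left[OF operator_id]] by blast
  obtain pr where pr: "\<And>X. computes pr X (right X)"
    using operator_computes[OF operator_right[OF operator_id]] by blast
  obtain j1 where j1: "\<And>X Y Z. computes (subst pl F1) X Y \<Longrightarrow> computes pr X Z \<Longrightarrow> computes j1 X (Y \<oplus> Z)"
    using computes_join by blast
  obtain j2 where j2: "\<And>X Y Z. computes pl X Y \<Longrightarrow> computes (subst j1 B2) X Z \<Longrightarrow> computes j2 X (Y \<oplus> Z)"
    using computes_join by blast
  have "\<exists>X''. computes (subst F1 F2) X X'' \<and> X'' \<in> dom_problem R \<and>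
     (\<forall>Y'' \<in> R X''. \<exists>Y. computes (subst j2 B1) (X \<oplus> Y'') Y \<and> Y \<in> P X)"
    if X: "X \<in> dom_problem P" for X
  proof -
    obtain X' where X': "computes F1 X X'" "X' \<in> dom_problem Q"
      "\<And>Y'. Y' \<in> Q X' \<Longrightarrow> \<exists>Y. computes B1 (X \<oplus> Y') Y \<and> Y \<in> P X"
      using 1[OF X] by blast
    obtain X'' where X'': "computes F2 X' X''" "X'' \<in> dom_problem R"
      "\<And>Y'. Y' \<in> R X'' \<Longrightarrow> \<exists>Y. computes B2 (X' \<oplus> Y') Y \<and> Y \<in> Q X'"
      using 2[OF X'(2)] by blast
    have "\<exists>Y. computes (subst j2 B1) (X \<oplus> Y'') Y \<and> Y \<in> P X" if Y'': "Y'' \<in> R X''" for Y''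
    proof -
      obtain Y' where Y': "computes B2 (X' \<oplus> Y'') Y'" "Y' \<in> Q X'"
        using X''(3)[OF Y''] by blast
      obtain Y where Y: "computes B1 (X \<oplus> Y') Y" "Y \<in> P X"
        using X'(3)[OF Y'(2)] by blast
      have l: "computes pl (X \<oplus> Y'') X" and r: "computes pr (X \<oplus> Y'') Y''"
        using pl[of "X \<oplus> Y''"] pr[of "X \<oplus> Y''"] by simp_all
      have "computes j1 (X \<oplus> Y'') (X' \<oplus> Y'')"
        by (rule j1[OF computes_subst[OF l X'(1)] r])
      then have "computes j2 (X \<oplus> Y'') (X \<oplus> Y')"
        by (intro j2 l computes_subst[OF _ Y'(1)])
      then show ?thesis using Y computes_subst by blast
    qed
    then show ?thesis using X''(2) computes_subst[OF X'(1) X''(1)] by blast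
  qed
  then show ?thesis unfolding W_le_def by blast
qed

section \<open>Evaluation with bounded minimisation and partial oracles\<close>

text \<open>The state is \<open>0\<close> while all values seen so far are defined and nonzero, \<open>1\<close> once an undefined
  value has been met, and \<open>m + 2\<close> once the least zero \<open>m\<close> has been found. Subtracting \<open>1\<close> therefore
  gives the coding of partial values that \<open>run\<close> uses.\<close>

definition mu_search :: "(nat \<Rightarrow> nat) \<Rightarrow> nat \<Rightarrow> nat" where
  "mu_search f = rec_nat 0 (\<lambda>i st. if st = 0
     then (case f i of 0 \<Rightarrow> 1 | Suc v \<Rightarrow> (case v of 0 \<Rightarrow> Suc (Suc i) | Suc _ \<Rightarrow> 0)) else st)"

text \<open>A partial value is coded as \<open>0\<close> (undefined) or \<open>Suc v\<close>, and the oracle \<open>f\<close> answers in the same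
  way. Minimisation is the only source of divergence in Kleene's schemes, so it suffices to bound
  each minimisation by \<open>s\<close> in order to make evaluation total.\<close>

primrec run :: "(nat \<Rightarrow> nat) \<Rightarrow> nat \<Rightarrow> functional \<Rightarrow> nat \<Rightarrow> nat" where
  "run f s TZero = (\<lambda>n. 1)"
| "run f s TSucc = (\<lambda>n. Suc (Suc n))"
| "run f s TFst = (\<lambda>n. Suc (nfst n))"
| "run f s TSnd = (\<lambda>n. Suc (nsnd n))"
| "run f s TOracle = (\<lambda>n. f n)"
| "run f s (TPair p q) = (\<lambda>n. case run f s p n of 0 \<Rightarrow> 0 | Suc a \<Rightarrow>
     (case run f s q n of 0 \<Rightarrow> 0 | Suc b \<Rightarrow> Suc \<langle>a, b\<rangle>))"
| "run f s (TComp p q) = (\<lambda>n. case run f s q n of 0 \<Rightarrow> 0 | Suc a \<Rightarrow> run f s p a)"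
| "run f s (TPrec p q) = (\<lambda>n. rec_nat (run f s p (nfst n))
     (\<lambda>i r. case r of 0 \<Rightarrow> 0 | Suc v \<Rightarrow> run f s q \<langle>nfst n, \<langle>i, v\<rangle>\<rangle>) (nsnd n))"
| "run f s (TMu p) = (\<lambda>n. mu_search (\<lambda>i. run f s p \<langle>n, i\<rangle>) s - 1)"

text \<open>Induction on the program. It replaces a universal machine: the program that computes
  \<open>run\<close> may depend on \<open>p\<close>. The parameter \<open>nfst z\<close> allows the oracle to vary with the input.\<close>

lemma computable_run:
  assumes "computable (\<lambda>X z. Or X (nfst z) (nsnd z))"
  shows "computable (\<lambda>X z. run (Or X (nfst z)) (nfst (nsnd z)) p (nsnd (nsnd z)))"
proof (induction p)
  case TOracle
  show ?case by (simp, intro computable_intros computable_comp2[OF assms])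
next
  case (TPair p q)
  show ?case
    by (simp, intro computable_intros computable_comp3[OF TPair(1)] computable_comp3[OF TPair(2)])
next
  case (TComp p q)
  show ?case
    by (simp, intro computable_intros computable_comp3[OF TComp(1)] computable_comp3[OF TComp(2)])
next
  case (TPrec p q)
  show ?case
    by (simp, intro computable_intros computable_comp3[OF TPrec(1)] computable_comp3[OF TPrec(2)])
next
  case (TMu p)
  show ?case
    by (simp add: mu_search_def, intro computable_intros computable_comp3[OF TMu])
qed (simp_all, (intro computable_intros)+)

lemma mu_search_sound:
  "(mu_search f s = 0 \<longrightarrow> (\<forall>i<s. \<exists>r. f i = Suc (Suc r))) \<and>
   (\<forall>m. mu_search f s = Suc (Suc m) \<longrightarrow> f m = Suc 0 \<and> (\<forall>i<m. \<exists>r. f i = Suc (Suc r)))"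
  by (induction s) (auto simp: mu_search_def less_Suc_eq split: nat.splits if_splits)

lemma mu_search_complete:
  assumes "f m = Suc 0" "\<And>i. i < m \<Longrightarrow> \<exists>r. f i = Suc (Suc r)" "m < s"
  shows "mu_search f s = Suc (Suc m)"
proof -
  \<comment> \<open>The search is still going on up to \<open>m\<close>, and its state never changes after \<open>m\<close>.\<close>
  have zero: "k \<le> m \<Longrightarrow> mu_search f k = 0" for k
  proof (induction k)
    case (Suc k)
    then obtain r where "f k = Suc (Suc r)" using assms(2)[of k] by auto
    then show ?case using Suc by (simp add: mu_search_def)
  qed (simp add: mu_search_def)
  have "mu_search f (Suc m + d) = Suc (Suc m)" for d
  proof (induction d)
    case 0
    then show ?case using zero[of m] assms(1) by (simp add: mu_search_def)
  qed (simp add: mu_search_def)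
  from this[of "s - Suc m"] show ?thesis using assms(3) by simp
qed

lemma run_sound:
  assumes "\<And>j v. Or j = Suc v \<Longrightarrow> v = of_bool (j \<in> X)"
    and "run Or s p n = Suc m"
  shows "eval X p n m"
  using assms(2)
proof (induction p arbitrary: n m)
  case TOracle
  then show ?case using assms(1) eval_oracle by fastforce
next
  case (TComp p q)
  then show ?case by (auto intro: eval_comp TComp.IH split: nat.splits)
next
  case (TPrec p q)
  have "rec_nat (run Or s p a) (\<lambda>i r. case r of 0 \<Rightarrow> 0 | Suc v \<Rightarrow> run Or s q \<langle>a, \<langle>i, v\<rangle>\<rangle>) k = Suc m
    \<Longrightarrow> eval X (TPrec p q) \<langle>a, k\<rangle> m" for a k m
    by (induction k arbitrary: m)
      (auto intro: eval.intros TPrec.IH split: nat.splits)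
  from this[of "nfst n" "nsnd n"] show ?case using TPrec.prems by simp
next
  case (TMu p)
  then have "mu_search (\<lambda>i. run Or s p \<langle>n, i\<rangle>) s = Suc (Suc m)" by simp
  with mu_search_sound[of "\<lambda>i. run Or s p \<langle>n, i\<rangle>" s]
  have "run Or s p \<langle>n, m\<rangle> = Suc 0" "\<forall>i<m. \<exists>r. run Or s p \<langle>n, i\<rangle> = Suc (Suc r)" by auto
  then show ?case using TMu.IH by (meson eval_mu)
qed (auto intro: eval.intros split: nat.splits)

text \<open>The oracle may vary with the bound, as long as each single answer is eventually correct: a
  halting computation asks finitely many questions.\<close>

lemma run_complete:
  assumes Or: "\<And>j. \<forall>\<^sub>F s in sequentially. Or s j = Suc (of_bool (j \<in> X))"
    and "eval X p n m"
  shows "\<forall>\<^sub>F s in sequentially. run (Or s) s p n = Suc m"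
  using assms(2)
proof (induction rule: eval.induct)
  case (eval_oracle n)
  then show ?case using Or by simp
next
  case (eval_pair p n a q b)
  from eval_pair.IH show ?case by eventually_elim simp
next
  case (eval_comp q n a p b)
  from eval_comp.IH show ?case by eventually_elim simp
next
  case (eval_prec_0 p a b q)
  from eval_prec_0.IH show ?case by eventually_elim simp
next
  case (eval_prec_Suc p q a m r b)
  from eval_prec_Suc.IH show ?case by eventually_elim simp
next
  case (eval_mu p a m)
  have "\<forall>i\<in>{..<m}. \<forall>\<^sub>F s in sequentially. \<exists>r. run (Or s) s p \<langle>a, i\<rangle> = Suc (Suc r)"
  proof
    fix i assume "i \<in> {..<m}"
    then obtain r where "\<forall>\<^sub>F s in sequentially. run (Or s) s p \<langle>a, i\<rangle> = Suc (Suc r)"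
      using eval_mu.IH(2) by auto
    then show "\<forall>\<^sub>F s in sequentially. \<exists>r. run (Or s) s p \<langle>a, i\<rangle> = Suc (Suc r)"
      by eventually_elim blast
  qed
  then have "\<forall>\<^sub>F s in sequentially. \<forall>i\<in>{..<m}. \<exists>r. run (Or s) s p \<langle>a, i\<rangle> = Suc (Suc r)"
    by (rule eventually_ball_finite[OF finite_lessThan])
  with eval_mu.IH(1) eventually_gt_at_top[of m] show ?case
  proof eventually_elim
    case (elim s)
    then have "mu_search (\<lambda>i. run (Or s) s p \<langle>a, i\<rangle>) s = Suc (Suc m)"
      by (intro mu_search_complete) auto
    then show ?case by simp
  qed
qed auto


section \<open>Associates of functionals\<close>

text \<open>The first \<open>l\<close> bits of \<open>Y\<close> as a left-nested tuple, the last bit being outermost.\<close>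

definition prefix_code :: "cantor \<Rightarrow> nat \<Rightarrow> nat" where
  "prefix_code Y = rec_nat 0 (\<lambda>i r. \<langle>r, of_bool (i \<in> Y)\<rangle>)"

definition prefix_bit :: "nat \<Rightarrow> nat \<Rightarrow> nat \<Rightarrow> nat" where
  "prefix_bit \<sigma> l i = nsnd (rec_nat \<sigma> (\<lambda>_ r. nfst r) (l - Suc i))"

lemma prefix_bit_prefix_code:
  assumes "i < l"
  shows "prefix_bit (prefix_code Y l) l i = of_bool (i \<in> Y)"
proof -
  have "d \<le> l \<Longrightarrow> rec_nat (prefix_code Y l) (\<lambda>_ r. nfst r) d = prefix_code Y (l - d)" for d
  proof (induction d)
    case (Suc d)
    then have "l - d = Suc (l - Suc d)" by simp
    then show ?case using Suc by (simp add: prefix_code_def)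
  qed simp
  from this[of "l - Suc i"] show ?thesis
    using assms by (simp add: prefix_bit_def prefix_code_def)
qed

lemma computable_prefix_code [computable_intros]:
  "operator G \<Longrightarrow> computable f \<Longrightarrow> computable (\<lambda>X n. prefix_code (G X) (f X n))"
  unfolding prefix_code_def by (intro computable_intros decidable_member)

text \<open>The oracle \<open>X \<oplus> Y\<close> when only the first \<open>l\<close> bits of \<open>Y\<close>, coded by \<open>\<sigma>\<close>, are known.\<close>

definition prefix_oracle :: "cantor \<Rightarrow> nat \<Rightarrow> nat \<Rightarrow> nat \<Rightarrow> nat" where
  "prefix_oracle X \<sigma> l j = (if even j then Suc (of_bool (j div 2 \<in> X))
     else if j div 2 < l then Suc (prefix_bit \<sigma> l (j div 2)) else 0)"

text \<open>The table of \<open>\<Theta>\<close> as a functional of the second half of its oracle, with \<open>X\<close> as a parameter.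
  The length \<open>l\<close> of the prefix also bounds the minimisations.\<close>

definition associate :: "functional \<Rightarrow> cantor \<Rightarrow> cantor" where
  "associate \<Theta> X = {\<langle>n, \<langle>\<sigma>, \<langle>l, v\<rangle>\<rangle>\<rangle> | n \<sigma> l v. run (prefix_oracle X \<sigma> l) l \<Theta> n = Suc v}"

lemma operator_associate: "operator (associate \<Theta>)"
proof -
  have "computable (\<lambda>X z. prefix_oracle X (nfst (nfst z)) (nsnd (nfst z)) (nsnd z))"
    unfolding prefix_oracle_def prefix_bit_def by (intro computable_intros)
  from computable_run[where Or = "\<lambda>X a. prefix_oracle X (nfst a) (nsnd a)", OF this]
  have run: "computable (\<lambda>X z. run (prefix_oracle X (nfst (nfst z)) (nsnd (nfst z)))
    (nfst (nsnd z)) \<Theta> (nsnd (nsnd z)))" .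
  let ?\<sigma> = "\<lambda>w. nfst (nsnd w)" and ?l = "\<lambda>w. nfst (nsnd (nsnd w))"
  have "computable (\<lambda>X w. run (prefix_oracle X (?\<sigma> w) (?l w)) (?l w) \<Theta> (nfst w))"
    using computable_comp[OF run, of "\<lambda>X w. \<langle>\<langle>?\<sigma> w, ?l w\<rangle>, \<langle>?l w, nfst w\<rangle>\<rangle>"]
    by (simp add: computable_intros)
  then have "operator (\<lambda>X. {w. run (prefix_oracle X (?\<sigma> w) (?l w)) (?l w) \<Theta> (nfst w)
    = Suc (nsnd (nsnd (nsnd w)))})"
    by (intro computable_intros)
  moreover have "associate \<Theta> = (\<lambda>X. {w. run (prefix_oracle X (?\<sigma> w) (?l w)) (?l w) \<Theta> (nfst w)
    = Suc (nsnd (nsnd (nsnd w)))})"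
    unfolding associate_def by (auto simp: fun_eq_iff, metis prod.collapse prod_decode_inverse)
  ultimately show ?thesis by (simp only:)
qed

text \<open>Search for a prefix of \<open>Y\<close> on which the table has an entry for \<open>n\<close>. Long prefixes have one by
  \<open>run_complete\<close>, and by \<open>run_sound\<close> every entry agrees with \<open>\<Theta>\<close>. The program \<open>ap\<close> is the
  same for all \<open>\<Theta>\<close>.\<close>

lemma computes_associate:
  "\<exists>ap. \<forall>\<Theta> X Y Z. computes \<Theta> (X \<oplus> Y) Z \<longrightarrow> computes ap (associate \<Theta> X \<oplus> Y) Z"
proof -
  define entry where "entry W n t v \<longleftrightarrow> \<langle>n, \<langle>prefix_code (right W) t, \<langle>t, v\<rangle>\<rangle>\<rangle> \<in> left W" for W n t v
  have "decidable (\<lambda>W z. entry W (nfst z) (nsnd z) 0 \<or> entry W (nfst z) (nsnd z) 1)"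
    "decidable (\<lambda>W z. entry W (nfst z) (nsnd z) 1)"
    unfolding entry_def by (intro computable_intros)+
  from search_computes[where R = "\<lambda>W n t. entry W n t 0 \<or> entry W n t 1" and V = "\<lambda>W n t. entry W n t 1", OF this]
  obtain ap where ap: "\<And>W. \<forall>n. \<exists>t. entry W n t 0 \<or> entry W n t 1 \<Longrightarrow>
      computes ap W {n. entry W n (LEAST t. entry W n t 0 \<or> entry W n t 1) 1}" by blast
  have "computes ap (associate \<Theta> X \<oplus> Y) Z" if \<Theta>: "computes \<Theta> (X \<oplus> Y) Z" for \<Theta> X Y Z
  proof -
    let ?W = "associate \<Theta> X \<oplus> Y" and ?O = "\<lambda>t. prefix_oracle X (prefix_code Y t) t"
    have entry: "entry ?W n t v \<longleftrightarrow> run (?O t) t \<Theta> n = Suc v" for n t v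
      by (simp add: entry_def associate_def)
    have sound: "v = of_bool (n \<in> Z)" if e: "entry ?W n t v" for n t v
    proof -
      have or: "u = of_bool (j \<in> X \<oplus> Y)" if "?O t j = Suc u" for j u
        using that by (auto simp: prefix_oracle_def mem_join prefix_bit_prefix_code split: if_splits)
      have "eval (X \<oplus> Y) \<Theta> n v"
        by (rule run_sound[OF or e[unfolded entry]])
      then show ?thesis using \<Theta> eval_deterministic unfolding computes_def by blast
    qed
    have sound: "entry ?W n t 0 \<Longrightarrow> n \<notin> Z" "entry ?W n t 1 \<Longrightarrow> n \<in> Z" for n t
      using sound[of n t 0] sound[of n t 1] by (cases "n \<in> Z"; auto)+
    have ex: "\<exists>t. entry ?W n t 0 \<or> entry ?W n t 1" for n
    proof -
      have "\<forall>\<^sub>F t in sequentially. ?O t j = Suc (of_bool (j \<in> X \<oplus> Y))" for j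
        using eventually_gt_at_top[of "j div 2"]
        by eventually_elim (simp add: prefix_oracle_def mem_join prefix_bit_prefix_code)
      moreover have "eval (X \<oplus> Y) \<Theta> n (of_bool (n \<in> Z))"
        using \<Theta> by (simp add: computes_def)
      ultimately have "\<forall>\<^sub>F t in sequentially. run (?O t) t \<Theta> n = Suc (of_bool (n \<in> Z))"
        by (rule run_complete)
      then obtain t where "entry ?W n t (of_bool (n \<in> Z))"
        unfolding entry by (auto simp: eventually_sequentially)
      then show ?thesis by (cases "n \<in> Z") auto
    qed
    have "entry ?W n (LEAST t. entry ?W n t 0 \<or> entry ?W n t 1) 1 \<longleftrightarrow> n \<in> Z" for n
      using LeastI_ex[OF ex[of n]] sound(1,2) by blast
    then show ?thesis using ap[of ?W] ex by simp
  qed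
  then show ?thesis by blast
qed

section \<open>Existence of the compositional product\<close>

text \<open>The maximum is represented by \<open>U1 \<circ>\<^sub>p U0\<close>. An instance of \<open>U0\<close> is a \<open>P0\<close>-instance
  joined with an arbitrary set; \<open>U1\<close> reads this set as an associate, applies it to the
  \<open>P0\<close>-solution, and solves the resulting \<open>P1\<close>-instance. Both keep their input in the output, so
  that a final solution still contains both intermediate solutions. Given reductions of \<open>Q1\<close> and
  \<open>Q0\<close>, the associate to supply is that of the backward functional of \<open>Q0\<close> followed by the
  forward functional of \<open>Q1\<close>.\<close>

lemma comp_product_nonempty:
  "\<exists>S \<in> P1 \<star> P0. \<forall>Q1 Q0. Q1 \<le>\<^sub>W P1 \<longrightarrow> Q0 \<le>\<^sub>W P0 \<longrightarrow> Q1 \<circ>\<^sub>p Q0 \<le>\<^sub>W S"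
proof -
  obtain ap where ap: "\<And>\<Theta> X Y Z. computes \<Theta> (X \<oplus> Y) Z \<Longrightarrow> computes ap (associate \<Theta> X \<oplus> Y) Z"
    using computes_associate by blast
  define U0 :: problem where "U0 I = {I \<oplus> Y | Y. Y \<in> P0 (left I)}" for I
  define U1 :: problem where
    "U1 M = {M \<oplus> y | y E. computes ap (right (left M) \<oplus> right M) E \<and> y \<in> P1 E}" for M
  obtain pl where pl: "\<And>X. computes pl X (left X)"
    using operator_computes[OF operator_left[OF operator_id]] by blast
  have U0: "U0 \<le>\<^sub>W P0"
    unfolding W_le_def
  proof (intro exI ballI)
    fix I assume "I \<in> dom_problem U0"
    then show "computes pl I (left I) \<and> left I \<in> dom_problem P0 \<and>
      (\<forall>Y' \<in> P0 (left I). \<exists>Y. computes TOracle (I \<oplus> Y') Y \<and> Y \<in> U0 I)"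
      using pl computes_oracle by (auto simp: dom_problem_def U0_def)
  qed
  have "operator (\<lambda>M. right (left M) \<oplus> right M)"
    by (intro computable_intros)
  then obtain sh where sh: "\<And>M. computes sh M (right (left M) \<oplus> right M)"
    using operator_computes by blast
  have U1: "U1 \<le>\<^sub>W P1"
    unfolding W_le_def
  proof (rule exI, rule exI, rule ballI)
    fix M assume "M \<in> dom_problem U1"
    then obtain y E where E: "computes ap (right (left M) \<oplus> right M) E" "y \<in> P1 E"
      by (auto simp: dom_problem_def U1_def)
    have "computes (subst sh ap) M E"
      using computes_subst[OF sh E(1)] .
    then show "\<exists>E. computes (subst sh ap) M E \<and> E \<in> dom_problem P1 \<and>
      (\<forall>y \<in> P1 E. \<exists>Y. computes TOracle (M \<oplus> y) Y \<and> Y \<in> U1 M)"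
      using E computes_oracle by (auto simp: dom_problem_def U1_def)
  qed
  have max: "Q1 \<circ>\<^sub>p Q0 \<le>\<^sub>W U1 \<circ>\<^sub>p U0" if Q: "Q1 \<le>\<^sub>W P1" "Q0 \<le>\<^sub>W P0" for Q1 Q0
  proof -
    obtain F1 B1 where 1: "\<And>X. X \<in> dom_problem Q1 \<Longrightarrow> \<exists>X'. computes F1 X X' \<and> X' \<in> dom_problem P1 \<and>
       (\<forall>Y' \<in> P1 X'. \<exists>Y. computes B1 (X \<oplus> Y') Y \<and> Y \<in> Q1 X)"
      using Q(1) unfolding W_le_def by blast
    obtain F0 B0 where 0: "\<And>X. X \<in> dom_problem Q0 \<Longrightarrow> \<exists>X'. computes F0 X X' \<and> X' \<in> dom_problem P0 \<and>
       (\<forall>Y' \<in> P0 X'. \<exists>Y. computes B0 (X \<oplus> Y') Y \<and> Y \<in> Q0 X)"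
      using Q(2) unfolding W_le_def by blast
    let ?\<Theta> = "subst B0 F1"
    obtain as where as: "\<And>X. computes as X (associate ?\<Theta> X)"
      using operator_computes[OF operator_associate] by blast
    obtain F where F: "\<And>X Y Z. computes F0 X Y \<Longrightarrow> computes as X Z \<Longrightarrow> computes F X (Y \<oplus> Z)"
      using computes_join by blast
    \<comment> \<open>The oracle \<open>M\<close> is the original instance \<open>X\<close> joined with a solution \<open>(I \<oplus> Y) \<oplus> w\<close> of the
      maximum; \<open>xy\<close> extracts \<open>X \<oplus> Y\<close> and \<open>y\<close> extracts \<open>w\<close>.\<close>
    have "operator (\<lambda>M. left M \<oplus> right (left (right M)))" "operator (\<lambda>M. right (right M))"
      by (intro computable_intros)+
    then obtain xy y where xy: "\<And>M. computes xy M (left M \<oplus> right (left (right M)))"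
      and y: "\<And>M. computes y M (right (right M))"
      using operator_computes by meson
    obtain zy where zy: "\<And>X Y Z. computes (subst xy B0) X Y \<Longrightarrow> computes y X Z \<Longrightarrow> computes zy X (Y \<oplus> Z)"
      using computes_join by blast
    show ?thesis
      unfolding W_le_def
    proof (rule exI, rule exI, rule ballI)
      fix X assume "X \<in> dom_problem (Q1 \<circ>\<^sub>p Q0)"
      then have X: "X \<in> dom_problem Q0" "Q0 X \<subseteq> dom_problem Q1"
        by (auto simp: dom_problem_def problem_comp_def split: if_splits)
      then have comp: "(Q1 \<circ>\<^sub>p Q0) X = (\<Union>Y \<in> Q0 X. Q1 Y)"
        by (simp add: problem_comp_def)
      obtain X0 where X0: "computes F0 X X0" "X0 \<in> dom_problem P0"
        and B0: "\<And>Y. Y \<in> P0 X0 \<Longrightarrow> \<exists>Z. computes B0 (X \<oplus> Y) Z \<and> Z \<in> Q0 X"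
        using 0[OF X(1)] by blast
      let ?I = "X0 \<oplus> associate ?\<Theta> X"
      have step: "\<exists>Z E. computes B0 (X \<oplus> Y) Z \<and> Z \<in> Q0 X \<and> E \<in> dom_problem P1 \<and>
          computes ap (associate ?\<Theta> X \<oplus> Y) E \<and>
          (\<forall>y \<in> P1 E. \<exists>V. computes B1 (Z \<oplus> y) V \<and> V \<in> Q1 Z)" if Y: "Y \<in> P0 X0" for Y
      proof -
        obtain Z where Z: "computes B0 (X \<oplus> Y) Z" "Z \<in> Q0 X" using B0[OF Y] by blast
        obtain E where E: "computes F1 Z E" "E \<in> dom_problem P1"
          "\<forall>y \<in> P1 E. \<exists>V. computes B1 (Z \<oplus> y) V \<and> V \<in> Q1 Z"
          using 1[of Z] Z(2) X(2) by blast
        show ?thesis using Z E ap[OF computes_subst[OF Z(1) E(1)]] by blast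
      qed
      have dom0: "?I \<in> dom_problem U0"
        using X0(2) by (auto simp: dom_problem_def U0_def)
      have "U0 ?I \<subseteq> dom_problem U1"
        using step by (fastforce simp: dom_problem_def U0_def U1_def)
      then have comp': "(U1 \<circ>\<^sub>p U0) ?I = (\<Union>Y \<in> U0 ?I. U1 Y)" and "?I \<in> dom_problem (U1 \<circ>\<^sub>p U0)"
        using dom0 by (auto simp: problem_comp_def dom_problem_def)
      moreover have "\<exists>V. computes (subst zy B1) (X \<oplus> N) V \<and> V \<in> (Q1 \<circ>\<^sub>p Q0) X"
        if N: "N \<in> (U1 \<circ>\<^sub>p U0) ?I" for N
      proof -
        obtain Y w E' where Y: "Y \<in> P0 X0" and N: "N = (?I \<oplus> Y) \<oplus> w"
          and E': "computes ap (associate ?\<Theta> X \<oplus> Y) E'" "w \<in> P1 E'"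
          using N unfolding comp' by (auto simp: U0_def U1_def)
        obtain Z E where Z: "computes B0 (X \<oplus> Y) Z" "Z \<in> Q0 X"
          and E: "computes ap (associate ?\<Theta> X \<oplus> Y) E"
            "\<forall>y \<in> P1 E. \<exists>V. computes B1 (Z \<oplus> y) V \<and> V \<in> Q1 Z"
          using step[OF Y] by blast
        \<comment> \<open>The \<open>P1\<close>-instance solved by \<open>w\<close> is the intended one because \<open>ap\<close> has one output.\<close>
        have "E' = E" using computes_unique E'(1) E(1) .
        then obtain V where V: "computes B1 (Z \<oplus> w) V" "V \<in> Q1 Z" using E' E by blast
        have "computes (subst xy B0) (X \<oplus> N) Z" "computes y (X \<oplus> N) w"
          using computes_subst[OF xy[of "X \<oplus> N"], of B0 Z] Z(1) y[of "X \<oplus> N"] by (simp_all add: N)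
        from computes_subst[OF zy[OF this] V(1)] show ?thesis
          using Z(2) V(2) unfolding comp by blast
      qed
      ultimately show "\<exists>I. computes F X I \<and> I \<in> dom_problem (U1 \<circ>\<^sub>p U0) \<and>
        (\<forall>N \<in> (U1 \<circ>\<^sub>p U0) I. \<exists>V. computes (subst zy B1) (X \<oplus> N) V \<and> V \<in> (Q1 \<circ>\<^sub>p Q0) X)"
        using F[OF X0(1) as] by blast
    qed
  qed
  have "U1 \<circ>\<^sub>p U0 \<in> P1 \<star> P0"
    unfolding comp_product_def W_max_def W_equiv_def
    using U0 U1 max W_le_refl by blast
  then show ?thesis using max by blast
qed

section \<open>Removing the choice on the natural numbers at the cost of finitely many errors\<close>

text \<open>The candidate at stage \<open>t\<close>: it moves on by one whenever it is found to be refuted.\<close>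

definition guess :: "cantor \<Rightarrow> nat \<Rightarrow> nat" where
  "guess E = rec_nat 0 (\<lambda>s x. if \<langle>x, s\<rangle> \<in> E then Suc x else x)"

lemma computable_guess [computable_intros]:
  "operator G \<Longrightarrow> computable f \<Longrightarrow> computable (\<lambda>X n. guess (G X) (f X n))"
  unfolding guess_def by (intro computable_intros decidable_member)

text \<open>The candidate never passes a correct solution, so it is bounded and finally constant. Its
  final value is not refuted at late stages. It was not refuted earlier either, since then \<open>e\<close>
  would have changed twice.\<close>

lemma guess_converges:
  assumes "E \<in> dom_problem CN"
  shows "\<exists>x t0. {x} \<in> CN E \<and> (\<forall>t\<ge>t0. guess E t = x)"
proof -
  obtain e where e: "CN_instance e" and E: "E = {\<langle>y, s\<rangle> | y s. e y s = 1}"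
    using assms unfolding dom_CN by blast
  have mem: "\<langle>y, s\<rangle> \<in> E \<longleftrightarrow> e y s = 1" for y s by (simp add: E)
  obtain b where b: "\<And>s. e b s = 0" using e unfolding CN_instance_def by blast
  have Suc: "guess E (Suc t) = (if \<langle>guess E t, t\<rangle> \<in> E then Suc (guess E t) else guess E t)" for t
    by (simp add: guess_def)
  have le: "guess E t \<le> b" for t
  proof (induction t)
    case (Suc t)
    show ?case
    proof (cases "guess E t = b")
      case True
      then show ?thesis using b by (simp add: \<open>guess E (Suc t) = _\<close> mem)
    next
      case False
      then show ?thesis using Suc by (simp add: \<open>guess E (Suc t) = _\<close>)
    qed
  qed (simp add: guess_def)
  have mono: "mono (guess E)"
    by (rule incseq_SucI) (simp add: Suc)
  have fin: "finite (range (guess E))"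
    by (rule finite_subset[of _ "{..b}"]) (use le in auto)
  define x where "x = Max (range (guess E))"
  obtain t0 where t0: "guess E t0 = x"
    using Max_in[OF fin] unfolding x_def by auto
  have const: "guess E t = x" if "t0 \<le> t" for t
    using monoD[OF mono that] Max_ge[OF fin, of "guess E t"] t0 unfolding x_def by auto
  have late: "e x t = 0" if "t0 \<le> t" for t
  proof -
    have "\<langle>x, t\<rangle> \<notin> E"
      using Suc[of t] const[OF that] const[of "Suc t"] that by auto
    moreover have "e x t < 2" using e unfolding CN_instance_def by blast
    ultimately show ?thesis by (simp add: mem)
  qed
  have change: "\<exists>u\<ge>a. u < a + d \<and> g u \<noteq> g (u + 1)" if "g a \<noteq> g (a + d)" for g :: "nat \<Rightarrow> nat" and a d
    using that
  proof (induction d)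
    case (Suc d)
    then show ?case
      by (cases "g a = g (a + d)") (auto intro: exI[of _ "a + d"] less_SucI)
  qed simp
  have "e x s = 0" for s
  proof (rule ccontr)
    assume s: "e x s \<noteq> 0"
    then have "s < t0" using late[of s] by (cases "t0 \<le> s") auto
    have "e x 0 = 0" and one: "\<exists>\<^sub>\<le>\<^sub>1 s. e x s \<noteq> e x (s + 1)"
      using e unfolding CN_instance_def by blast+
    obtain u where u: "u < s" "e x u \<noteq> e x (u + 1)"
      using change[of "e x" 0 s] s \<open>e x 0 = 0\<close> unfolding add_0 by metis
    obtain v where v: "s \<le> v" "e x v \<noteq> e x (v + 1)"
      using change[of "e x" s "t0 - s"] s late[OF order_refl]
      unfolding le_add_diff_inverse[OF less_imp_le[OF \<open>s < t0\<close>]] by metis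
    have "u = v" using one u(2) v(2) unfolding Uniq_def by blast
    then show False using u(1) v(1) by simp
  qed
  then have "{x} \<in> CN E" unfolding CN_def using e E by auto
  then show ?thesis using const by blast
qed

text \<open>If \<open>\<Theta>\<close> turns every \<open>CN\<close>-solution of \<open>E\<close> into a set, then one such set can be computed
  from \<open>E\<close> itself up to finitely many errors: \<open>\<Xi>\<close> runs \<open>\<Theta>\<close> with the current candidate for
  longer and longer and takes the first answer. The search starts at stage \<open>n\<close> on input \<open>n\<close>; this
  confines the wrong candidates to finitely many inputs.\<close>

lemma finite_error_functional:
  "\<exists>\<Xi>. \<forall>A E. E \<in> dom_problem CN \<longrightarrow> (\<forall>x. {x} \<in> CN E \<longrightarrow> (\<exists>Z. computes \<Theta> (A \<oplus> {x}) Z)) \<longrightarrow>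
     (\<exists>x Y Z. {x} \<in> CN E \<and> computes \<Theta> (A \<oplus> {x}) Z \<and> computes \<Xi> (A \<oplus> E) Y \<and>
        finite ((Y - Z) \<union> (Z - Y)))"
proof -
  \<comment> \<open>The answers of the oracle \<open>left X \<oplus> {x}\<close>, with \<open>x\<close> as a parameter.\<close>
  define Or where "Or X x j = Suc (of_bool (if even j then j div 2 \<in> left X else j div 2 = x))"
    for X x j
  define val where "val X n t = run (Or X (guess (right X) t)) t \<Theta> n" for X n t
  have "decidable (\<lambda>X z. even (nsnd z) \<and> nsnd z div 2 \<in> left X \<or>
      \<not> even (nsnd z) \<and> nsnd z div 2 = nfst z)"
    by (intro computable_intros)
  then have "computable (\<lambda>X z. Or X (nfst z) (nsnd z))"
    unfolding Or_def if_bool_eq_disj by (intro computable_Suc)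
  note run = computable_run[OF this]
  have val: "computable (\<lambda>X z. val X (nfst z) (nsnd z))"
    unfolding val_def by (rule computable_comp3[OF run]) (intro computable_intros)+
  \<comment> \<open>\<open>2\<close> codes the defined value \<open>1\<close>. Other outputs, possible for wrong candidates, count as \<open>0\<close>.\<close>
  have "decidable (\<lambda>X z. nfst z \<le> nsnd z \<and> 0 < val X (nfst z) (nsnd z))"
    "decidable (\<lambda>X z. val X (nfst z) (nsnd z) = 2)"
    by (intro computable_intros val)+
  from search_computes[where R = "\<lambda>X n t. n \<le> t \<and> 0 < val X n t" and V = "\<lambda>X n t. val X n t = 2",
    OF this]
  obtain \<Xi> where \<Xi>: "\<And>X. \<forall>n. \<exists>t. n \<le> t \<and> 0 < val X n t \<Longrightarrow>
    computes \<Xi> X {n. val X n (LEAST t. n \<le> t \<and> 0 < val X n t) = 2}" by blast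
  have "\<exists>x Y Z. {x} \<in> CN E \<and> computes \<Theta> (A \<oplus> {x}) Z \<and> computes \<Xi> (A \<oplus> E) Y \<and>
        finite ((Y - Z) \<union> (Z - Y))"
    if E: "E \<in> dom_problem CN" and ex: "\<forall>x. {x} \<in> CN E \<longrightarrow> (\<exists>Z. computes \<Theta> (A \<oplus> {x}) Z)" for A E
  proof -
    obtain x t0 where x: "{x} \<in> CN E" and t0: "\<And>t. t0 \<le> t \<Longrightarrow> guess E t = x"
      using guess_converges[OF E] by blast
    obtain Z where Z: "computes \<Theta> (A \<oplus> {x}) Z" using ex x by blast
    let ?X = "A \<oplus> E"
    have Or: "Or ?X x j = Suc (of_bool (j \<in> A \<oplus> {x}))" for j
      by (simp add: Or_def mem_join)
    have run: "val ?X n t = run (Or ?X x) t \<Theta> n" if "t0 \<le> t" for n t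
      using t0[OF that] by (simp add: val_def)
    have sound: "val ?X n t = Suc (of_bool (n \<in> Z))" if t: "t0 \<le> t" "0 < val ?X n t" for n t
    proof -
      obtain v where v: "run (Or ?X x) t \<Theta> n = Suc v"
        using t(2) gr0_conv_Suc unfolding run[OF t(1)] by blast
      then have "eval (A \<oplus> {x}) \<Theta> n v"
        by (rule run_sound[rotated]) (simp add: Or)
      then have "v = of_bool (n \<in> Z)"
        using Z eval_deterministic unfolding computes_def by blast
      then show ?thesis using v run[OF t(1)] by simp
    qed
    have ex: "\<exists>t. n \<le> t \<and> 0 < val ?X n t" for n
    proof -
      have "\<forall>\<^sub>F t in sequentially. run (Or ?X x) t \<Theta> n = Suc (of_bool (n \<in> Z))"
        by (rule run_complete[where Or = "\<lambda>_. Or ?X x" and X = "A \<oplus> {x}"])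
          (use Z in \<open>auto simp: Or computes_def\<close>)
      then have "\<forall>\<^sub>F t in sequentially. n \<le> t \<and> 0 < val ?X n t"
        using eventually_ge_at_top[of n] eventually_ge_at_top[of t0]
        by eventually_elim (simp add: run)
      then show ?thesis by (auto simp: eventually_sequentially)
    qed
    define Y where "Y = {n. val ?X n (LEAST t. n \<le> t \<and> 0 < val ?X n t) = 2}"
    have "computes \<Xi> ?X Y" unfolding Y_def using ex by (intro \<Xi>) blast
    moreover have "n \<in> Y \<longleftrightarrow> n \<in> Z" if "t0 \<le> n" for n
      using LeastI_ex[OF ex[of n]] sound[of "LEAST t. n \<le> t \<and> 0 < val ?X n t" n] that
      by (cases "n \<in> Z") (auto simp: Y_def)
    then have "(Y - Z) \<union> (Z - Y) \<subseteq> {..<t0}"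
      by (auto simp: not_le[symmetric])
    then have "finite ((Y - Z) \<union> (Z - Y))" by (rule finite_subset) simp
    ultimately show ?thesis using x Z by blast
  qed
  then show ?thesis by blast
qed

text \<open>With an \<open>R\<close>-solution at hand, both the \<open>CN\<close>-instance and the map from its solutions to
  \<open>P\<close>-solutions are given by functionals, and \<open>finite_error_functional\<close> applies.\<close>

lemma FE_le_of_le_comp_CN:
  assumes "P \<le>\<^sub>W Q1 \<circ>\<^sub>p Q0" "Q1 \<le>\<^sub>W CN" "Q0 \<le>\<^sub>W R"
  shows "FE P \<le>\<^sub>W R"
proof -
  obtain F B where P: "\<And>X. X \<in> dom_problem P \<Longrightarrow> \<exists>X'. computes F X X' \<and> X' \<in> dom_problem (Q1 \<circ>\<^sub>p Q0) \<and>
     (\<forall>Y' \<in> (Q1 \<circ>\<^sub>p Q0) X'. \<exists>Y. computes B (X \<oplus> Y') Y \<and> Y \<in> P X)"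
    using assms(1) unfolding W_le_def by blast
  obtain F1 B1 where 1: "\<And>X. X \<in> dom_problem Q1 \<Longrightarrow> \<exists>X'. computes F1 X X' \<and> X' \<in> dom_problem CN \<and>
     (\<forall>Y' \<in> CN X'. \<exists>Y. computes B1 (X \<oplus> Y') Y \<and> Y \<in> Q1 X)"
    using assms(2) unfolding W_le_def by blast
  obtain F0 B0 where 0: "\<And>X. X \<in> dom_problem Q0 \<Longrightarrow> \<exists>X'. computes F0 X X' \<and> X' \<in> dom_problem R \<and>
     (\<forall>Y' \<in> R X'. \<exists>Y. computes B0 (X \<oplus> Y') Y \<and> Y \<in> Q0 X)"
    using assms(3) unfolding W_le_def by blast
  obtain pl where pl: "\<And>X Y. computes pl (X \<oplus> Y) X"
    using operator_computes[OF operator_left[OF operator_id]] by (metis left_join)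
  obtain pr where pr: "\<And>X Y. computes pr (X \<oplus> Y) Y"
    using operator_computes[OF operator_right[OF operator_id]] by (metis right_join)
  obtain j1 where j1: "\<And>X Y Z. computes (subst pl F) X Y \<Longrightarrow> computes pr X Z \<Longrightarrow> computes j1 X (Y \<oplus> Z)"
    using computes_join by blast
  \<comment> \<open>With \<open>A = X \<oplus> Y0\<close>, where \<open>Y0\<close> solves the \<open>R\<close>-instance: \<open>?z\<close> computes the \<open>Q0\<close>-solution \<open>Z0\<close>
    from \<open>A\<close>; \<open>j2\<close> computes \<open>Z0 \<oplus> {x}\<close>, and \<open>j3\<close> computes \<open>X\<close> joined with the \<open>Q1\<close>-solution,
    both from \<open>A \<oplus> {x}\<close>; \<open>j4\<close> joins \<open>A\<close> with the \<open>CN\<close>-instance.\<close>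
  let ?z = "subst j1 B0"
  obtain j2 where j2: "\<And>X Y Z. computes (subst pl ?z) X Y \<Longrightarrow> computes pr X Z \<Longrightarrow> computes j2 X (Y \<oplus> Z)"
    using computes_join by blast
  obtain j3 where j3: "\<And>X Y Z. computes (subst pl pl) X Y \<Longrightarrow> computes (subst j2 B1) X Z \<Longrightarrow> computes j3 X (Y \<oplus> Z)"
    using computes_join by blast
  obtain \<Xi> where \<Xi>: "\<And>A E. E \<in> dom_problem CN \<Longrightarrow>
     (\<forall>x. {x} \<in> CN E \<longrightarrow> (\<exists>Z. computes (subst j3 B) (A \<oplus> {x}) Z)) \<Longrightarrow>
     (\<exists>x Y Z. {x} \<in> CN E \<and> computes (subst j3 B) (A \<oplus> {x}) Z \<and> computes \<Xi> (A \<oplus> E) Y \<and>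
        finite ((Y - Z) \<union> (Z - Y)))"
    using finite_error_functional by meson
  obtain j4 where j4: "\<And>X Y Z. computes TOracle X Y \<Longrightarrow> computes (subst ?z F1) X Z \<Longrightarrow> computes j4 X (Y \<oplus> Z)"
    using computes_join by blast
  have "\<exists>X''. computes (subst F F0) X X'' \<and> X'' \<in> dom_problem R \<and>
     (\<forall>Y0 \<in> R X''. \<exists>Y. computes (subst j4 \<Xi>) (X \<oplus> Y0) Y \<and> Y \<in> FE P X)"
    if X: "X \<in> dom_problem (FE P)" for X
  proof -
    obtain X' where X': "computes F X X'" "X' \<in> dom_problem (Q1 \<circ>\<^sub>p Q0)"
      and B: "\<And>Y'. Y' \<in> (Q1 \<circ>\<^sub>p Q0) X' \<Longrightarrow> \<exists>Y. computes B (X \<oplus> Y') Y \<and> Y \<in> P X"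
      using P[of X] X dom_FE by blast
    have dom: "X' \<in> dom_problem Q0" "Q0 X' \<subseteq> dom_problem Q1"
      using X'(2) by (auto simp: dom_problem_def problem_comp_def split: if_splits)
    then have comp: "(Q1 \<circ>\<^sub>p Q0) X' = (\<Union>Y \<in> Q0 X'. Q1 Y)"
      by (simp add: problem_comp_def)
    obtain X'' where X'': "computes F0 X' X''" "X'' \<in> dom_problem R"
      and B0: "\<And>Y'. Y' \<in> R X'' \<Longrightarrow> \<exists>Y. computes B0 (X' \<oplus> Y') Y \<and> Y \<in> Q0 X'"
      using 0[OF dom(1)] by blast
    have "\<exists>Y. computes (subst j4 \<Xi>) (X \<oplus> Y0) Y \<and> Y \<in> FE P X" if Y0: "Y0 \<in> R X''" for Y0
    proof -
      obtain Z0 where Z0: "computes B0 (X' \<oplus> Y0) Z0" "Z0 \<in> Q0 X'"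
        using B0[OF Y0] by blast
      obtain E where E: "computes F1 Z0 E" "E \<in> dom_problem CN"
        and B1: "\<And>Y'. Y' \<in> CN E \<Longrightarrow> \<exists>Y. computes B1 (Z0 \<oplus> Y') Y \<and> Y \<in> Q1 Z0"
        using 1[of Z0] Z0(2) dom(2) by blast
      let ?A = "X \<oplus> Y0"
      have z: "computes ?z ?A Z0"
        by (intro computes_subst[OF _ Z0(1)] j1 computes_subst[OF pl X'(1)] pr)
      have sol: "\<exists>Z. computes (subst j3 B) (?A \<oplus> {x}) Z \<and> Z \<in> P X" if x: "{x} \<in> CN E" for x
      proof -
        obtain Z1 where Z1: "computes B1 (Z0 \<oplus> {x}) Z1" "Z1 \<in> Q1 Z0" using B1[OF x] by blast
        obtain Z where Z: "computes B (X \<oplus> Z1) Z" "Z \<in> P X"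
          using B[of Z1] Z1(2) Z0(2) unfolding comp by blast
        have "computes j2 (?A \<oplus> {x}) (Z0 \<oplus> {x})"
          by (intro j2 computes_subst[OF pl z] pr)
        then have "computes j3 (?A \<oplus> {x}) (X \<oplus> Z1)"
          by (intro j3 computes_subst[OF pl pl] computes_subst[OF _ Z1(1)])
        then show ?thesis using Z computes_subst by blast
      qed
      obtain x Y Z where Y: "{x} \<in> CN E" "computes (subst j3 B) (?A \<oplus> {x}) Z"
        "computes \<Xi> (?A \<oplus> E) Y" "finite ((Y - Z) \<union> (Z - Y))"
        using \<Xi>[OF E(2), of ?A] sol by blast
      have "Z \<in> P X" using sol[OF Y(1)] Y(2) computes_unique by blast
      then have "Y \<in> FE P X" using Y(4) unfolding FE_def by blast
      moreover have "computes j4 ?A (?A \<oplus> E)"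
        by (intro j4 computes_oracle computes_subst[OF z E(1)])
      then have "computes (subst j4 \<Xi>) ?A Y" using Y(3) computes_subst by blast
      ultimately show ?thesis by blast
    qed
    then show ?thesis using X'' computes_subst[OF X'(1) X''(1)] by blast
  qed
  then show ?thesis unfolding W_le_def by blast
qed

section \<open>Repairing finitely many errors in a homogeneous set\<close>

text \<open>Covers \<^const>\<open>RT2\<close> and \<^const>\<open>SRT2\<close> at once.\<close>

definition homogeneous_set_problem :: "(nat \<Rightarrow> nat \<Rightarrow> nat) set \<Rightarrow> problem" where
  "homogeneous_set_problem C X = {H. \<exists>c \<in> C. X = coloring_code c \<and> infinite H \<and> homogeneous c H}"

text \<open>Two pairs in \<open>H\<close> above \<open>n\<close>, only the first of which has colour \<open>j\<close> in the coloring coded by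
  \<open>X\<close>. Since \<open>X\<close> is the graph of the coloring, naming \<open>j\<close> makes this decidable.\<close>

definition clash :: "cantor \<Rightarrow> cantor \<Rightarrow> nat \<Rightarrow> nat \<Rightarrow> nat \<Rightarrow> nat \<Rightarrow> nat \<Rightarrow> nat \<Rightarrow> bool" where
  "clash X H n x y x' y' j \<longleftrightarrow> n \<le> x \<and> x < y \<and> n \<le> x' \<and> x' < y' \<and>
     x \<in> H \<and> y \<in> H \<and> x' \<in> H \<and> y' \<in> H \<and> \<langle>\<langle>x, y\<rangle>, j\<rangle> \<in> X \<and> \<langle>\<langle>x', y'\<rangle>, j\<rangle> \<notin> X"

definition clash_code :: "cantor \<Rightarrow> nat \<Rightarrow> nat \<Rightarrow> bool" where
  "clash_code W n w \<longleftrightarrow> clash (left W) (right W) n (nfst (nfst w)) (nsnd (nfst w))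
     (nfst (nfst (nsnd w))) (nsnd (nfst (nsnd w))) (nsnd (nsnd w))"

text \<open>The \<open>CN\<close>-instance in which \<open>n\<close> is refuted at the first stage past the code of a clash above
  \<open>n\<close>.\<close>

definition clash_set :: "cantor \<Rightarrow> cantor" where
  "clash_set W = {z. \<exists>w < nsnd z. clash_code W (nfst z) w}"

definition tail :: "cantor \<Rightarrow> nat \<Rightarrow> cantor" where
  "tail H n = {h \<in> H. n \<le> h}"

lemma clash_code_iff:
  "(\<exists>w. clash_code W n w) \<longleftrightarrow> (\<exists>x y x' y' j. clash (left W) (right W) n x y x' y' j)"
proof
  assume "\<exists>x y x' y' j. clash (left W) (right W) n x y x' y' j"
  then obtain x y x' y' j where "clash (left W) (right W) n x y x' y' j" by blast
  then have "clash_code W n \<langle>\<langle>x, y\<rangle>, \<langle>\<langle>x', y'\<rangle>, j\<rangle>\<rangle>" by (simp add: clash_code_def)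
  then show "\<exists>w. clash_code W n w" by blast
qed (unfold clash_code_def, blast)

lemma operator_clash_set: "operator clash_set"
proof -
  have "operator (\<lambda>W. clash_set W)"
    unfolding clash_set_def clash_code_def clash_def by (intro computable_intros)
  then show ?thesis .
qed

lemma CN_clash_set:
  assumes "\<nexists>w. clash_code W n w"
  shows "clash_set W \<in> dom_problem CN"
proof -
  define e :: "nat \<Rightarrow> nat \<Rightarrow> nat" where "e n s = of_bool (\<exists>w<s. clash_code W n w)" for n s
  have "e m s \<noteq> e m (s + 1) \<longleftrightarrow> clash_code W m s \<and> (\<forall>w<s. \<not> clash_code W m w)" for m s
    by (auto simp: e_def less_Suc_eq)
  then have "s = t" if "e m s \<noteq> e m (s + 1)" "e m t \<noteq> e m (t + 1)" for m s t
    using that by (meson linorder_neqE_nat)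
  then have "\<exists>\<^sub>\<le>\<^sub>1 s. e m s \<noteq> e m (s + 1)" for m unfolding Uniq_def by blast
  moreover have "e n s = 0" for s using assms by (simp add: e_def)
  ultimately have "CN_instance e" unfolding CN_instance_def by (auto simp: e_def)
  moreover have "clash_set W = {\<langle>y, s\<rangle> | y s. e y s = 1}"
    unfolding clash_set_def e_def by (auto, metis prod.collapse prod_decode_inverse)
  ultimately show ?thesis unfolding dom_CN by blast
qed

lemma CN_clash_setD:
  assumes "{n} \<in> CN (clash_set W)"
  shows "\<not> clash_code W n w"
proof
  assume w: "clash_code W n w"
  obtain e where e: "clash_set W = {\<langle>y, s\<rangle> | y s. e y s = (1::nat)}" "\<And>s. e n s = 0"
    using assms unfolding CN_def by auto
  have "\<langle>n, Suc w\<rangle> \<in> clash_set W" using w by (auto simp: clash_set_def)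
  then show False using e by auto
qed

lemma coloring_code_iff: "\<langle>\<langle>x, y\<rangle>, j\<rangle> \<in> coloring_code c \<longleftrightarrow> x < y \<and> j = c x y"
  by (auto simp: coloring_code_def)

lemma homogeneous_tail_iff:
  assumes "infinite H"
  shows "homogeneous c (tail H n) \<longleftrightarrow> (\<nexists>x y x' y' j. clash (coloring_code c) H n x y x' y' j)"
proof
  assume "homogeneous c (tail H n)"
  then show "\<nexists>x y x' y' j. clash (coloring_code c) H n x y x' y' j"
    unfolding homogeneous_def clash_def tail_def coloring_code_iff
    by (smt (verit) le_trans less_imp_le mem_Collect_eq)
next
  assume no: "\<nexists>x y x' y' j. clash (coloring_code c) H n x y x' y' j"
  obtain a b where ab: "a \<in> H" "b \<in> H" "n \<le> a" "a < b"
    using assms by (meson infinite_nat_iff_unbounded infinite_nat_iff_unbounded_le)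
  have "c x y = c a b" if "x \<in> tail H n" "y \<in> tail H n" "x < y" for x y
  proof (rule ccontr)
    assume "c x y \<noteq> c a b"
    then have "clash (coloring_code c) H n x y a b (c x y)"
      using that ab by (simp add: clash_def tail_def coloring_code_iff)
    then show False using no by blast
  qed
  then show "homogeneous c (tail H n)" unfolding homogeneous_def by blast
qed

lemma infinite_tail: "infinite H \<Longrightarrow> infinite (tail H n)"
  unfolding tail_def infinite_nat_iff_unbounded_le
  by (metis (no_types, lifting) max.bounded_iff mem_Collect_eq)

text \<open>\<open>Q0\<close> keeps the coloring next to the faulty homogeneous set \<open>H\<close>, so that \<open>Q1\<close> can look for clashes;
  \<open>Q1\<close> then removes from \<open>H\<close> the initial segment that \<open>CN\<close> chooses.\<close>

lemma homogeneous_set_problem_le_comp: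
  fixes C
  defines "P \<equiv> homogeneous_set_problem C"
  shows "\<exists>Q1 Q0. Q1 \<le>\<^sub>W CN \<and> Q0 \<le>\<^sub>W FE P \<and> P \<le>\<^sub>W Q1 \<circ>\<^sub>p Q0"
proof -
  define Q0 :: problem where "Q0 X = {X \<oplus> H | H. H \<in> FE P X}" for X
  define Q1 :: problem where "Q1 W = {tail (right W) n | n. {n} \<in> CN (clash_set W)}" for W
  have dom_Q0: "dom_problem Q0 = dom_problem P"
    using dom_FE[of P] by (auto simp: dom_problem_def Q0_def)
  have Q0: "Q0 \<le>\<^sub>W FE P"
    unfolding W_le_def
  proof (intro exI ballI)
    fix X assume "X \<in> dom_problem Q0"
    then show "computes TOracle X X \<and> X \<in> dom_problem (FE P) \<and>
      (\<forall>H \<in> FE P X. \<exists>Y. computes TOracle (X \<oplus> H) Y \<and> Y \<in> Q0 X)"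
      using computes_oracle by (auto simp: dom_Q0 dom_FE Q0_def)
  qed
  obtain cl where cl: "\<And>W. computes cl W (clash_set W)"
    using operator_computes[OF operator_clash_set] by blast
  \<comment> \<open>When \<open>right X = {n}\<close>, the bounded quantifier says \<open>n \<le> h\<close>.\<close>
  have "operator (\<lambda>X. {h. h \<in> right (left X) \<and> (\<exists>i<Suc h. i \<in> right X)})"
    by (intro computable_intros)
  then obtain ta where ta: "\<And>X. computes ta X {h. h \<in> right (left X) \<and> (\<exists>i<Suc h. i \<in> right X)}"
    using operator_computes by blast
  have ta: "computes ta (W \<oplus> {n}) (tail (right W) n)" for W n
    using ta[of "W \<oplus> {n}"] by (simp add: tail_def less_Suc_eq_le)
  have Q1: "Q1 \<le>\<^sub>W CN"
    unfolding W_le_def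
  proof (intro exI ballI)
    fix W assume "W \<in> dom_problem Q1"
    then have "clash_set W \<in> dom_problem CN" by (auto simp: dom_problem_def Q1_def)
    moreover have "\<exists>Y. computes ta (W \<oplus> N) Y \<and> Y \<in> Q1 W" if N: "N \<in> CN (clash_set W)" for N
    proof -
      obtain n where "N = {n}" using N unfolding CN_def by blast
      then show ?thesis using ta N unfolding Q1_def by blast
    qed
    ultimately show "computes cl W (clash_set W) \<and> clash_set W \<in> dom_problem CN \<and>
      (\<forall>N \<in> CN (clash_set W). \<exists>Y. computes ta (W \<oplus> N) Y \<and> Y \<in> Q1 W)"
      using cl by blast
  qed
  obtain pr where pr: "\<And>X Y. computes pr (X \<oplus> Y) Y"
    using operator_computes[OF operator_right[OF operator_id]] by (metis right_join)
  have "P \<le>\<^sub>W Q1 \<circ>\<^sub>p Q0"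
    unfolding W_le_def
  proof (intro exI ballI)
    fix X assume X: "X \<in> dom_problem P"
    have FE: "\<exists>c \<in> C. \<exists>n. X = coloring_code c \<and> infinite H \<and> homogeneous c (tail H n)"
      if H: "H \<in> FE P X" for H
    proof -
      obtain c Z where c: "c \<in> C" "X = coloring_code c" "infinite Z" "homogeneous c Z"
        and fin: "finite ((H - Z) \<union> (Z - H))"
        using H unfolding FE_def P_def homogeneous_set_problem_def by blast
      have "infinite H"
        using c(3) fin finite_subset[of Z "H \<union> ((H - Z) \<union> (Z - H))"] by auto
      moreover obtain n where "\<forall>h \<in> (H - Z) \<union> (Z - H). h < n"
        using fin finite_nat_set_iff_bounded by blast
      then have "tail H n \<subseteq> Z" unfolding tail_def using leD by blast
      then have "homogeneous c (tail H n)"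
        using c(4) unfolding homogeneous_def by (meson subsetD)
      ultimately show ?thesis using c(1,2) by blast
    qed
    have dom1: "clash_set (X \<oplus> H) \<in> dom_problem CN" if H: "H \<in> FE P X" for H
    proof -
      obtain n where "\<nexists>w. clash_code (X \<oplus> H) n w"
        using FE[OF H] unfolding clash_code_iff left_join right_join
        by (metis homogeneous_tail_iff)
      then show ?thesis using CN_clash_set by blast
    qed
    have sol: "tail H n \<in> P X" if H: "H \<in> FE P X" and n: "{n} \<in> CN (clash_set (X \<oplus> H))" for H n
    proof -
      obtain c where c: "c \<in> C" "X = coloring_code c" "infinite H" using FE[OF H] by blast
      have "\<nexists>w. clash_code (X \<oplus> H) n w" using CN_clash_setD[OF n] by blast
      then have "homogeneous c (tail H n)"
        unfolding homogeneous_tail_iff[OF c(3)] clash_code_iff by (simp add: c(2))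
      then show ?thesis
        using c infinite_tail unfolding P_def homogeneous_set_problem_def by blast
    qed
    have sub: "Q0 X \<subseteq> dom_problem Q1"
    proof
      fix W assume "W \<in> Q0 X"
      then obtain H where H: "W = X \<oplus> H" "H \<in> FE P X" by (auto simp: Q0_def)
      then obtain N where "N \<in> CN (clash_set W)" using dom1 by (auto simp: dom_problem_def)
      moreover then obtain n where "N = {n}" unfolding CN_def by blast
      ultimately show "W \<in> dom_problem Q1" by (auto simp: dom_problem_def Q1_def)
    qed
    then have comp: "(Q1 \<circ>\<^sub>p Q0) X = (\<Union>Y \<in> Q0 X. Q1 Y)"
      using X by (simp add: problem_comp_def dom_Q0)
    have "X \<in> dom_problem (Q1 \<circ>\<^sub>p Q0)"
      using sub X unfolding dom_Q0[symmetric] by (auto simp: dom_problem_def comp)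
    moreover have "(Q1 \<circ>\<^sub>p Q0) X \<subseteq> P X"
      unfolding comp using sol by (auto simp: Q0_def Q1_def)
    ultimately show "computes TOracle X X \<and> X \<in> dom_problem (Q1 \<circ>\<^sub>p Q0) \<and>
      (\<forall>Y' \<in> (Q1 \<circ>\<^sub>p Q0) X. \<exists>Y. computes pr (X \<oplus> Y') Y \<and> Y \<in> P X)"
      using computes_oracle pr by blast
  qed
  then show ?thesis using Q0 Q1 by blast
qed

section \<open>The degree of the implication\<close>

text \<open>A lower bound that belongs to the class is its infimum up to equivalence, and infima form a
  whole degree.\<close>

lemma W_imp_eqI:
  assumes lower: "\<And>R. W_le_degree P (Q \<star> R) \<Longrightarrow> T \<le>\<^sub>W R" and mem: "W_le_degree P (Q \<star> T)"
  shows "W_degree T = (Q \<rightarrow>\<^sub>W P)"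
  unfolding W_degree_def W_imp_def W_inf_def W_equiv_def
  using lower mem W_le_trans W_le_refl by blast

theorem proposition1p9:
  fixes k :: nat and P :: problem
  assumes "k > 0"
    and "P \<in> {RT2 k, SRT2 k}"
  shows "W_degree (FE P) = (CN \<rightarrow>\<^sub>W P)"
proof (rule W_imp_eqI)
  fix R assume "W_le_degree P (CN \<star> R)"
  then obtain Q1 Q0 where "Q1 \<le>\<^sub>W CN" "Q0 \<le>\<^sub>W R" "P \<le>\<^sub>W Q1 \<circ>\<^sub>p Q0"
    unfolding W_le_degree_def comp_product_def W_max_def W_equiv_def
    using W_le_trans by blast
  then show "FE P \<le>\<^sub>W R" using FE_le_of_le_comp_CN by blast
next
  have "RT2 k = homogeneous_set_problem {c. coloring k c}"
    "SRT2 k = homogeneous_set_problem {c. coloring k c \<and> stable c}"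
    by (auto simp: fun_eq_iff RT2_def SRT2_def homogeneous_set_problem_def)
  then obtain C where "P = homogeneous_set_problem C" using assms(2) by blast
  then obtain Q1 Q0 where "Q1 \<le>\<^sub>W CN" "Q0 \<le>\<^sub>W FE P" "P \<le>\<^sub>W Q1 \<circ>\<^sub>p Q0"
    using homogeneous_set_problem_le_comp by blast
  moreover obtain S where "S \<in> CN \<star> FE P"
    "\<And>Q1 Q0. Q1 \<le>\<^sub>W CN \<Longrightarrow> Q0 \<le>\<^sub>W FE P \<Longrightarrow> Q1 \<circ>\<^sub>p Q0 \<le>\<^sub>W S"
    using comp_product_nonempty by meson
  ultimately show "W_le_degree P (CN \<star> FE P)"
    unfolding W_le_degree_def using W_le_trans by blast
qed

end
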